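(* Let $k$ be a positive integer. A signed graph $(G,\sigma)$ whose underlying graph $G$ is a partial $3$-tree admits a homomorphism to $SPC(k)$ if and only if it contains no element of $\mathcal{O}_{k+1}$ as a subgraph.
   Context: A signed graph $(G,\sigma)$ is a graph with $\sigma:E(G)\to\{+,-\}$; switching at a vertex negates the signs of its incident non-loop edges; the sign of a cycle is the product of its edge signs. A homomorphism $(G,\sigma)\to(H,\pi)$ is a graph homomorphism $f$ with $\sigma(C)=\pi(f(C))$ for every cycle $C$ of $G$ (equivalently, a switching of $(G,\sigma)$ followed by an adjacency- and sign-preserving map). A partial $3$-tree is a subgraph of a $3$-tree, where $3$-trees are obtained from $K_4$ by repeatedly adding a vertex adjacent to all vertices of an existing triangle (equivalently, graphs of treewidth at most $3$). $C_{-m}$ denotes the negative cycle of length $m$. $\mathcal{O}_m$ is the set of signed cycles that do not admit a homomorphism to $C_{-m}$, namely positive odd cycles, negative cycles of length less than $m$, and negative cycles whose length has parity different from that of $m$. The signed projective cube $SPC(k)$ has vertex set $\mathbb{Z}_2^k$, positive edges between vertices at Hamming distance $1$, and negative edges between vertices at Hamming distance $k$. *)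

theory Defs
  imports "HOL-Library.Z2"
begin

text \<open>Signed graphs may have loops and parallel edges: \<open>ends\<close> gives the one or two
  end vertices of an edge. Signs are the integers \<open>1\<close> and \<open>-1\<close>.\<close>

record ('v, 'e) sgraph =
  verts :: "'v set"
  edges :: "'e set"
  ends :: "'e \<Rightarrow> 'v set"
  esign :: "'e \<Rightarrow> int"

definition signed_graph :: "('v, 'e) sgraph \<Rightarrow> bool" where
  "signed_graph G \<longleftrightarrow>
     (\<forall>e \<in> edges G. ends G e \<subseteq> verts G \<and> card (ends G e) \<in> {1, 2} \<and> esign G e \<in> {1, -1})"

definition signed_subgraph :: "('v, 'e) sgraph \<Rightarrow> ('v, 'e) sgraph \<Rightarrow> bool" where
  "signed_subgraph H G \<longleftrightarrow> signed_graph H \<and> verts H \<subseteq> verts G \<and> edges H \<subseteq> edges G \<and>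
     (\<forall>e \<in> edges H. ends H e = ends G e \<and> esign H e = esign G e)"

text \<open>The edge \<open>es ! i\<close> joins \<open>vs ! i\<close> to its cyclic successor, so cycles of length 1 are
  loops and cycles of length 2 are pairs of distinct parallel edges.\<close>

definition cycle_in :: "('v, 'e) sgraph \<Rightarrow> 'v list \<Rightarrow> 'e list \<Rightarrow> bool" where
  "cycle_in G vs es \<longleftrightarrow>
     vs \<noteq> [] \<and> length es = length vs \<and> distinct vs \<and> distinct es \<and>
     set vs \<subseteq> verts G \<and> set es \<subseteq> edges G \<and>
     (\<forall>i < length vs. ends G (es ! i) = {vs ! i, vs ! (Suc i mod length vs)})"

definition sign_of :: "('v, 'e) sgraph \<Rightarrow> 'e list \<Rightarrow> int" where
  "sign_of G es = prod_list (map (esign G) es)"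

text \<open>With parallel edges a graph homomorphism has a vertex part \<open>f\<close> and an edge part \<open>g\<close>.
  The image of a cycle is a closed walk, whose sign counts edges with multiplicity.\<close>

definition signed_hom :: "('v, 'e) sgraph \<Rightarrow> ('w, 'f) sgraph \<Rightarrow> ('v \<Rightarrow> 'w) \<Rightarrow> ('e \<Rightarrow> 'f) \<Rightarrow> bool" where
  "signed_hom G H f g \<longleftrightarrow>
     (\<forall>v \<in> verts G. f v \<in> verts H) \<and>
     (\<forall>e \<in> edges G. g e \<in> edges H \<and> ends H (g e) = f ` ends G e) \<and>
     (\<forall>vs es. cycle_in G vs es \<longrightarrow> sign_of G es = sign_of H (map g es))"

definition admits_hom :: "('v, 'e) sgraph \<Rightarrow> ('w, 'f) sgraph \<Rightarrow> bool" where
  "admits_hom G H \<longleftrightarrow> (\<exists>f g. signed_hom G H f g)"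

definition signed_cycle :: "('v, 'e) sgraph \<Rightarrow> bool" where
  "signed_cycle C \<longleftrightarrow> signed_graph C \<and>
     (\<exists>vs es. cycle_in C vs es \<and> set vs = verts C \<and> set es = edges C)"

text \<open>All negative cycles of length \<open>m\<close> are switching equivalent; the representative
  with exactly one negative edge is used.\<close>

definition neg_cycle :: "nat \<Rightarrow> (nat, nat) sgraph" where
  "neg_cycle m = \<lparr>verts = {..<m}, edges = {..<m},
     ends = (\<lambda>i. {i, Suc i mod m}), esign = (\<lambda>i. if i = 0 then -1 else 1)\<rparr>"

definition O_class :: "nat \<Rightarrow> ('v, 'e) sgraph set" where
  "O_class m = {C. signed_cycle C \<and> \<not> admits_hom C (neg_cycle m)}"

definition hamming :: "bit list \<Rightarrow> bit list \<Rightarrow> nat" where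
  "hamming x y = card {i. i < length x \<and> x ! i \<noteq> y ! i}"

text \<open>An edge is the pair of its end set and its sign, so for \<open>k = 1\<close> the two vertices
  are joined by both a positive and a negative edge.\<close>

definition SPC :: "nat \<Rightarrow> (bit list, bit list set \<times> int) sgraph" where
  "SPC k = \<lparr>verts = {x. length x = k},
     edges = {({x, y}, 1) |x y. length x = k \<and> length y = k \<and> hamming x y = 1} \<union>
             {({x, y}, -1) |x y. length x = k \<and> length y = k \<and> hamming x y = k},
     ends = fst, esign = snd\<rparr>"

text \<open>Simple graphs, given by a vertex set and a set of two-element edges.\<close>

inductive three_tree :: "'v set \<Rightarrow> 'v set set \<Rightarrow> bool" where
  K4: "card V = 4 \<Longrightarrow> three_tree V {e. e \<subseteq> V \<and> card e = 2}"
| add_vertex: "three_tree V E \<Longrightarrow> v \<notin> V \<Longrightarrow> T \<subseteq> V \<Longrightarrow> card T = 3 \<Longrightarrow>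
    (\<forall>e. e \<subseteq> T \<and> card e = 2 \<longrightarrow> e \<in> E) \<Longrightarrow>
    three_tree (insert v V) (E \<union> {{v, t} |t. t \<in> T})"

text \<open>Being a subgraph is meant up to isomorphism; since 3-trees are finite, 3-trees on
  natural numbers suffice, and the vertex type of \<open>G\<close> need not have room for the
  additional vertices. A subgraph of a 3-tree is simple, hence the injectivity of \<open>ends\<close>.\<close>

definition partial_3_tree :: "('v, 'e) sgraph \<Rightarrow> bool" where
  "partial_3_tree G \<longleftrightarrow> inj_on (ends G) (edges G) \<and>
     (\<exists>(V :: nat set) E \<phi>. three_tree V E \<and> inj_on \<phi> (verts G) \<and> \<phi> ` verts G \<subseteq> V \<and>
        (\<forall>e \<in> edges G. \<phi> ` ends G e \<in> E))"

end

theory Submission imports Defs begin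

text \<open>Write \<open>n = k + 1\<close>. The switching double cover of \<open>SPC k\<close> is the hypercube on subsets of
  \<open>{..<n}\<close>, switching being complementation. So a homomorphism from \<open>G\<close> amounts to a map \<open>F\<close> into
  the hypercube for which \<open>F u\<close> and \<open>F v\<close> have distance 1 if \<open>uv\<close> is positive and \<open>n - 1\<close> if it
  is negative. If every cycle maps to the negative \<open>n\<close>-cycle, then the walk metric on the double
  cover of \<open>G\<close> gives antipodal vertices distance at least \<open>n\<close>. A minimal such metric below it (with
  antipodal distances exactly \<open>n\<close>) satisfies \<open>d u v + d u (-v) = n\<close>, since otherwise a shortcut
  could be added. For this metric every triple of vertices embeds isometrically into the
  hypercube. Finally, an embedding of three points extends to a fourth one as soon as all triples
  of the four points embed, so one can embed a 3-tree vertex by vertex.\<close>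

subsection \<open>Signed homomorphisms and cycles\<close>

lemma prod_cyclic_shift:
  fixes f :: "nat \<Rightarrow> 'a::comm_monoid_mult"
  assumes "0 < l"
  shows "(\<Prod>i<l. f (Suc i mod l)) = (\<Prod>i<l. f i)"
proof -
  obtain j where l: "l = Suc j" using assms gr0_implies_Suc by blast
  have "(\<Prod>i<l. f (Suc i mod l)) = (\<Prod>i<j. f (Suc i mod l)) * f 0"
    unfolding l by (simp add: mult.commute)
  also have "(\<Prod>i<j. f (Suc i mod l)) = (\<Prod>i<j. f (Suc i))"
    by (rule prod.cong) (auto simp: l)
  also have "\<dots> * f 0 = (\<Prod>i<l. f i)"
    unfolding l by (simp add: prod.lessThan_Suc_shift mult.commute del: prod.lessThan_Suc)
  finally show ?thesis .
qed

lemma prod_list_lessThan: "prod_list xs = (\<Prod>i<length xs. xs ! i)"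
  for xs :: "'a::comm_monoid_mult list"
  by (simp add: prod.list_conv_set_nth atLeast0LessThan)

lemma sign_of_nth: "sign_of G es = (\<Prod>i<length es. esign G (es ! i))"
  by (simp add: sign_of_def prod_list_lessThan)

text \<open>Along a cycle each vertex is met by two consecutive edge ends, so its factor
  \<open>\<tau> v\<close> enters squared and disappears. The sign condition on cycles thus reduces
  to a check on single edges.\<close>

lemma switching_signed_hom:
  assumes f: "\<And>v. v \<in> verts G \<Longrightarrow> f v \<in> verts H"
    and g: "\<And>e. e \<in> edges G \<Longrightarrow> g e \<in> edges H \<and> ends H (g e) = f ` ends G e"
    and \<tau>: "\<And>v. \<tau> v = 1 \<or> \<tau> v = -1"
    and sgn: "\<And>e u v. e \<in> edges G \<Longrightarrow> ends G e = {u, v} \<Longrightarrow> esign H (g e) = \<tau> u * \<tau> v * esign G e"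
  shows "signed_hom G H f g"
proof -
  have "sign_of G es = sign_of H (map g es)" if cyc: "cycle_in G vs es" for vs es
  proof -
    define l where "l = length vs"
    have l: "l > 0" "length es = l" using cyc by (auto simp: cycle_in_def l_def)
    have "sign_of H (map g es) = (\<Prod>i<l. esign H (g (es ! i)))"
      by (simp add: sign_of_nth l)
    also have "\<dots> = (\<Prod>i<l. \<tau> (vs ! i) * \<tau> (vs ! (Suc i mod l)) * esign G (es ! i))"
      using cyc by (intro prod.cong refl sgn) (auto simp: cycle_in_def l_def)
    also have "\<dots> = (\<Prod>i<l. \<tau> (vs ! i)) * (\<Prod>i<l. \<tau> (vs ! (Suc i mod l))) * sign_of G es"
      by (simp add: prod.distrib sign_of_nth l)
    also have "(\<Prod>i<l. \<tau> (vs ! (Suc i mod l))) = (\<Prod>i<l. \<tau> (vs ! i))"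
      using prod_cyclic_shift[OF l(1), of "\<lambda>i. \<tau> (vs ! i)"] .
    also have "(\<Prod>i<l. \<tau> (vs ! i)) * (\<Prod>i<l. \<tau> (vs ! i)) = (\<Prod>i<l. \<tau> (vs ! i) * \<tau> (vs ! i))"
      by (simp add: prod.distrib)
    also have "\<dots> = 1"
      using \<tau> by (intro prod.neutral) (metis minus_mult_minus mult_1)
    finally show ?thesis by simp
  qed
  with f g show ?thesis by (auto simp: signed_hom_def)
qed

text \<open>The numerical form of "not in \<open>O_class m\<close>" for a cycle of length
  \<open>l\<close> and sign \<open>s\<close>: a positive cycle is even, a negative one has the
  parity of \<open>m\<close> and length at least \<open>m\<close>.\<close>

definition admissible :: "nat \<Rightarrow> nat \<Rightarrow> int \<Rightarrow> bool" where
  "admissible m l s \<longleftrightarrow> (even l \<longleftrightarrow> s = 1 \<or> even m) \<and> (s = -1 \<longrightarrow> m \<le> l)"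

lemma prod_signs:
  fixes f :: "'a \<Rightarrow> int"
  assumes "\<And>i. i \<in> A \<Longrightarrow> f i \<in> {1, -1}"
  shows "prod f A \<in> {1, -1}"
  using assms
proof (induction A rule: infinite_finite_induct)
  case (insert x F)
  then have "f x \<in> {1, -1}" "prod f F \<in> {1, -1}" by blast+
  moreover have "prod f (insert x F) = f x * prod f F" using insert by simp
  ultimately show ?case by fastforce
qed auto

lemma prod_sign_card:
  "finite A \<Longrightarrow> (\<Prod>i\<in>A. if P i then -1 else 1 :: int) = (-1) ^ card {i\<in>A. P i}"
  by (simp flip: prod.inter_filter)

text \<open>An abstraction shared by \<open>SPC k\<close> and the negative cycle of length \<open>k + 1\<close>: the edges have
  \<open>m\<close> colours, colour 0 being the negative one, and for each \<open>j > 0\<close> the colours 0 and \<open>j\<close>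
  together form a cut, with sides given by \<open>\<psi> j\<close>. Hence a closed walk meets all colours equally
  often modulo 2.\<close>

lemma coloured_closed_walk_admissible:
  fixes \<psi> :: "nat \<Rightarrow> nat \<Rightarrow> bool" and c :: "nat \<Rightarrow> nat"
  assumes l: "0 < l" and m: "0 < m"
    and col: "\<And>i. i < l \<Longrightarrow> c i < m"
    and cut: "\<And>i j. i < l \<Longrightarrow> 0 < j \<Longrightarrow> j < m \<Longrightarrow> \<psi> j i \<noteq> \<psi> j (Suc i mod l) \<longleftrightarrow> c i = 0 \<or> c i = j"
  shows "admissible m l (\<Prod>i<l. if c i = 0 then -1 else 1)"
proof -
  define N where "N j = card {i\<in>{..<l}. c i = j}" for j
  have parity: "even (N j) \<longleftrightarrow> even (N 0)" if j: "0 < j" "j < m" for j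
  proof -
    \<comment> \<open>The two sides of the cut \<open>j\<close> are encoded as signs. The product
      over consecutive pairs counts the crossings modulo 2, and it is 1 because every factor occurs
      twice.\<close>
    define \<tau> :: "nat \<Rightarrow> int" where "\<tau> i = (if \<psi> j i then 1 else -1)" for i
    have "(-1) ^ N 0 * (-1) ^ N j = (\<Prod>i<l. (if c i = 0 then -1 else 1) * (if c i = j then -1 else 1 :: int))"
      by (simp add: prod.distrib N_def prod_sign_card)
    also have "\<dots> = (\<Prod>i<l. \<tau> i * \<tau> (Suc i mod l))"
    proof (rule prod.cong)
      fix i assume "i \<in> {..<l}"
      then have "\<psi> j i \<noteq> \<psi> j (Suc i mod l) \<longleftrightarrow> c i = 0 \<or> c i = j" using cut j by simp
      then show "(if c i = 0 then -1 else 1) * (if c i = j then -1 else 1) = \<tau> i * \<tau> (Suc i mod l)"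
        using j unfolding \<tau>_def by (cases "\<psi> j i"; cases "\<psi> j (Suc i mod l)") auto
    qed simp
    also have "\<dots> = (\<Prod>i<l. \<tau> i) * (\<Prod>i<l. \<tau> i)"
      using prod_cyclic_shift[OF l, of \<tau>] by (simp add: prod.distrib)
    also have "\<dots> = (\<Prod>i<l. \<tau> i * \<tau> i)" by (simp add: prod.distrib)
    also have "\<dots> = 1" by (rule prod.neutral) (auto simp: \<tau>_def)
    finally have "(-1 :: int) ^ (N 0 + N j) = 1" by (simp add: power_add)
    then show ?thesis by (auto simp: minus_one_power_iff split: if_splits)
  qed
  have l_sum: "l = (\<Sum>j<m. N j)"
  proof -
    have "(\<Sum>j<m. N j) = card (\<Union>j<m. {i\<in>{..<l}. c i = j})"
      unfolding N_def by (rule card_UN_disjoint[symmetric]) auto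
    also have "(\<Union>j<m. {i\<in>{..<l}. c i = j}) = {..<l}" using col by auto
    finally show ?thesis by simp
  qed
  have sgn: "(\<Prod>i<l. if c i = 0 then -1 else 1 :: int) = (-1) ^ N 0"
    by (simp add: prod_sign_card N_def)
  have N: "even (N j) \<longleftrightarrow> even (N 0)" if "j < m" for j
    using parity[of j] that by (cases "j = 0") auto
  show ?thesis
  proof (cases "even (N 0)")
    case True
    then have "even l" unfolding l_sum using N by (intro dvd_sum) auto
    with True show ?thesis by (simp add: sgn admissible_def)
  next
    case False
    \<comment> \<open>Every colour occurs an odd number of times, hence at least once. This yields
      both the parity of \<open>l\<close> and the bound \<open>m \<le> l\<close>.\<close>
    have "{j\<in>{..<m}. odd (N j)} = {..<m}" using False N by auto
    then have "even (\<Sum>j<m. N j) \<longleftrightarrow> even m"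
      by (subst even_sum_iff) auto
    moreover have "(\<Sum>j<m. 1) \<le> (\<Sum>j<m. N j)"
    proof (rule sum_mono)
      fix j assume "j \<in> {..<m}"
      then have "odd (N j)" using N False by auto
      then show "1 \<le> N j" by (cases "N j") auto
    qed
    ultimately have "even l \<longleftrightarrow> even m" "m \<le> l" unfolding l_sum by simp_all
    with False show ?thesis by (simp add: sgn admissible_def)
  qed
qed

section \<open>Images of cycles in the negative cycle and in the signed projective cube\<close>

lemma neg_cycle_image_admissible:
  assumes m: "2 \<le> m" and hom: "signed_hom C (neg_cycle m) f g" and cyc: "cycle_in C vs es"
  shows "admissible m (length vs) (sign_of C es)"
proof -
  define l where "l = length vs"
  have l: "0 < l" "length es = l" using cyc by (auto simp: cycle_in_def l_def)
  have e: "g (es ! i) < m"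
    "{g (es ! i), Suc (g (es ! i)) mod m} = {f (vs ! i), f (vs ! (Suc i mod l))}" if "i < l" for i
  proof -
    have "es ! i \<in> edges C" "ends C (es ! i) = {vs ! i, vs ! (Suc i mod l)}"
      using cyc that by (auto simp: cycle_in_def l_def)
    then show "g (es ! i) < m"
      "{g (es ! i), Suc (g (es ! i)) mod m} = {f (vs ! i), f (vs ! (Suc i mod l))}"
      using hom by (auto simp: signed_hom_def neg_cycle_def)
  qed
  have "admissible m l (\<Prod>i<l. if g (es ! i) = 0 then -1 else 1)"
  \<comment> \<open>The colour of an edge of the target is its index. Removing edges
    \<open>0\<close> and \<open>j\<close> cuts off the arc of the vertices \<open>1\<close> to
    \<open>j\<close>.\<close>
  proof (rule coloured_closed_walk_admissible[where \<psi> = "\<lambda>j i. 1 \<le> f (vs ! i) \<and> f (vs ! i) \<le> j"])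
    fix i j assume i: "i < l" and j: "0 < j" "j < m"
    have "1 \<le> g (es ! i) \<and> g (es ! i) \<le> j \<longleftrightarrow> 1 \<le> Suc (g (es ! i)) mod m \<and> Suc (g (es ! i)) mod m \<le> j
       \<longleftrightarrow> \<not> (g (es ! i) = 0 \<or> g (es ! i) = j)"
      using e(1)[OF i] j m by (cases "Suc (g (es ! i)) = m") auto
    with e(2)[OF i] show "(1 \<le> f (vs ! i) \<and> f (vs ! i) \<le> j) \<noteq>
       (1 \<le> f (vs ! (Suc i mod l)) \<and> f (vs ! (Suc i mod l)) \<le> j) \<longleftrightarrow>
       g (es ! i) = 0 \<or> g (es ! i) = j"
      by (auto simp: doubleton_eq_iff)
  qed (use e l m in auto)
  moreover have "sign_of C es = sign_of (neg_cycle m) (map g es)"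
    using hom cyc by (simp add: signed_hom_def)
  moreover have "\<dots> = (\<Prod>i<l. if g (es ! i) = 0 then -1 else 1)"
    by (simp add: sign_of_nth l neg_cycle_def)
  ultimately show ?thesis by (simp add: l_def)
qed

text \<open>A positive edge gets as colour one plus the coordinate that it flips; a negative edge
  flips all coordinates and gets colour 0. Coordinate \<open>j - 1\<close> therefore changes exactly
  on the colours \<open>0\<close> and \<open>j\<close>.\<close>

lemma SPC_image_admissible:
  assumes k: "1 \<le> k" and hom: "signed_hom C (SPC k) f g" and cyc: "cycle_in C vs es"
  shows "admissible (k + 1) (length vs) (sign_of C es)"
proof -
  define l where "l = length vs"
  have l: "0 < l" "length es = l" using cyc by (auto simp: cycle_in_def l_def)
  let ?col = "\<lambda>i c. c < k + 1 \<and> esign (SPC k) (g (es ! i)) = (if c = 0 then -1 else 1) \<and>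
     (\<forall>j. 0 < j \<longrightarrow> j < k + 1 \<longrightarrow>
        (f (vs ! i) ! (j - 1) \<noteq> f (vs ! (Suc i mod l)) ! (j - 1) \<longleftrightarrow> c = 0 \<or> c = j))"
  have "\<exists>c. ?col i c"
    if i: "i < l" for i
  proof -
    define x y where "x = f (vs ! i)" and "y = f (vs ! (Suc i mod l))"
    have e: "es ! i \<in> edges C" "ends C (es ! i) = {vs ! i, vs ! (Suc i mod l)}"
      using cyc i by (auto simp: cycle_in_def l_def)
    then have "g (es ! i) \<in> edges (SPC k)" "fst (g (es ! i)) = {x, y}"
      using hom by (auto simp: signed_hom_def SPC_def x_def y_def)
    then obtain x' y' s where g: "g (es ! i) = ({x', y'}, s)" and xy: "{x', y'} = {x, y}"
      and len: "length x' = k" "length y' = k"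
      and s: "s = 1 \<and> hamming x' y' = 1 \<or> s = -1 \<and> hamming x' y' = k"
      by (auto simp: SPC_def)
    have sym: "x' ! j \<noteq> y' ! j \<longleftrightarrow> x ! j \<noteq> y ! j" for j
      using xy by (auto simp: doubleton_eq_iff)
    show ?thesis
    \<comment> \<open>The sign decides and not the Hamming distance, as both distances agree for
      \<open>k = 1\<close>.\<close>
    proof (cases "s = 1")
      case True
      then have "card {i. i < k \<and> x' ! i \<noteq> y' ! i} = 1" using s len by (auto simp: hamming_def)
      then obtain a where a: "{i. i < k \<and> x' ! i \<noteq> y' ! i} = {a}" by (auto simp: card_1_singleton_iff)
      then have a': "j < k \<Longrightarrow> x' ! j \<noteq> y' ! j \<longleftrightarrow> j = a" "a < k" for j by blast+
      show ?thesis
      proof (intro exI[of _ "Suc a"] conjI allI impI)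
        show "esign (SPC k) (g (es ! i)) = (if Suc a = 0 then -1 else 1)"
          using True by (simp add: g SPC_def)
        fix j assume "0 < j" "j < k + 1"
        then have "x' ! (j - 1) \<noteq> y' ! (j - 1) \<longleftrightarrow> j - 1 = a" by (intro a') simp
        then show "f (vs ! i) ! (j - 1) \<noteq> f (vs ! (Suc i mod l)) ! (j - 1) \<longleftrightarrow> Suc a = 0 \<or> Suc a = j"
          using \<open>0 < j\<close> unfolding sym x_def y_def by linarith
      qed (use a' in simp)
    next
      case False
      then have "card {i. i < k \<and> x' ! i \<noteq> y' ! i} = card {..<k}" using s len by (auto simp: hamming_def)
      then have "{i. i < k \<and> x' ! i \<noteq> y' ! i} = {..<k}" by (intro card_subset_eq) auto
      then have a': "j < k \<Longrightarrow> x' ! j \<noteq> y' ! j" for j by blast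
      show ?thesis
      proof (intro exI[of _ 0] conjI allI impI)
        show "esign (SPC k) (g (es ! i)) = (if (0::nat) = 0 then -1 else 1)"
          using False s by (simp add: g SPC_def)
        fix j assume "0 < j" "j < k + 1"
        then have "x' ! (j - 1) \<noteq> y' ! (j - 1)" by (intro a') simp
        then show "f (vs ! i) ! (j - 1) \<noteq> f (vs ! (Suc i mod l)) ! (j - 1) \<longleftrightarrow> 0 = (0::nat) \<or> 0 = j"
          unfolding sym x_def y_def by simp
      qed simp
    qed
  qed
  then have "\<forall>i. \<exists>c. i < l \<longrightarrow> ?col i c" by blast
  then obtain c where c: "i < l \<Longrightarrow> ?col i (c i)" for i
    using choice[of "\<lambda>i c. i < l \<longrightarrow> ?col i c"] by blast
  have "sign_of C es = sign_of (SPC k) (map g es)"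
    using hom cyc by (simp add: signed_hom_def)
  also have "\<dots> = (\<Prod>i<l. if c i = 0 then -1 else 1)"
    using c by (simp add: sign_of_nth l)
  also have "admissible (k + 1) l \<dots>"
  proof (rule coloured_closed_walk_admissible[where \<psi> = "\<lambda>j i. f (vs ! i) ! (j - 1) = 0"])
    fix i j assume "i < l" "0 < j" "j < k + 1"
    then have "f (vs ! i) ! (j - 1) \<noteq> f (vs ! (Suc i mod l)) ! (j - 1) \<longleftrightarrow> c i = 0 \<or> c i = j"
      using c by blast
    then show "(f (vs ! i) ! (j - 1) = 0) \<noteq> (f (vs ! (Suc i mod l)) ! (j - 1) = 0) \<longleftrightarrow> c i = 0 \<or> c i = j"
      by (cases "f (vs ! i) ! (j - 1)"; cases "f (vs ! (Suc i mod l)) ! (j - 1)") auto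
  qed (use l c in auto)
  finally show ?thesis by (simp add: l_def)
qed

text \<open>Converse of \<open>neg_cycle_image_admissible\<close>: together they show that
  \<open>O_class m\<close> consists of exactly the signed cycles that are not admissible.\<close>

lemma admissible_admits_hom_neg_cycle:
  assumes m: "2 \<le> m" and C: "signed_graph C" and cyc: "cycle_in C vs es"
    and cov: "set vs = verts C" "set es = edges C"
    and adm: "admissible m (length vs) (sign_of C es)"
  shows "admits_hom C (neg_cycle m)"
proof -
  define l where "l = length vs"
  have l: "0 < l" "length es = l" "distinct vs" "distinct es"
    using cyc by (auto simp: cycle_in_def l_def)
  have es: "es ! i \<in> edges C" "ends C (es ! i) = {vs ! i, vs ! (Suc i mod l)}" if "i < l" for i
    using cyc that by (auto simp: cycle_in_def l_def)
  have sg: "esign C e = 1 \<or> esign C e = -1" if "e \<in> edges C" for e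
    using C that by (auto simp: signed_graph_def)
  have sC: "sign_of C es = (\<Prod>i<l. esign C (es ! i))" by (simp add: sign_of_nth l)
  have sC': "sign_of C es \<in> {1, -1}"
    unfolding sC using sg es(1) by (intro prod_signs) auto
  \<comment> \<open>\<open>q\<close> is the number of edges spent on winding around the target.
    Admissibility leaves an even number \<open>l - q\<close> of edges for running back and
    forth.\<close>
  define q where "q = (if sign_of C es = 1 then 0 else m)"
  have q: "even l \<longleftrightarrow> even q" "q \<le> l" "q = 0 \<or> q = m"
    using adm sC' by (auto simp: admissible_def q_def l_def)
  text \<open>A negative cycle winds once around the target and then runs back and forth along its
    negative edge; a positive one only does the latter.\<close>
  define F G where "F i = (if i < q then i else (i - q) mod 2)"
    and "G i = (if i < q then i else 0)" for i :: nat
  define iv ie where "iv v = (THE i. i < l \<and> vs ! i = v)" and "ie e = (THE i. i < l \<and> es ! i = e)" for v e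
  have iv: "iv (vs ! i) = i" if "i < l" for i
    unfolding iv_def using that l nth_eq_iff_index_eq[of vs] by (intro the_equality) (auto simp: l_def)
  have ie: "ie (es ! i) = i" if "i < l" for i
    unfolding ie_def using that l nth_eq_iff_index_eq[of es] by (intro the_equality) (auto simp: l_def)
  have v_ex: "\<exists>i<l. v = vs ! i" if "v \<in> verts C" for v
    using that in_set_conv_nth[of v vs] cov by (auto simp: l_def)
  have e_ex: "\<exists>i<l. e = es ! i" if "e \<in> edges C" for e
    using that in_set_conv_nth[of e es] cov l by auto
  have step: "{G i, Suc (G i) mod m} = {F i, F (Suc i mod l)}" if i: "i < l" for i
  proof (cases "i < q")
    case True
    then have "q = m" using q by auto
    then show ?thesis using True i q by (cases "Suc i = l"; cases "Suc i = m") (auto simp: F_def G_def)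
  next
    case False
    show ?thesis
    proof (cases "Suc i = l")
      case True
      then have "odd (i - q)" using q False by auto
      then have "F i = 1" using False by (simp add: F_def odd_iff_mod_2_eq_one del: even_diff_nat)
      then show ?thesis using False True m by (auto simp: F_def G_def)
    next
      case False2: False
      have "Suc i - q = Suc (i - q)" using False by auto
      then show ?thesis using False False2 i m
        by (cases "even (i - q)") (auto simp: F_def G_def odd_iff_mod_2_eq_one even_iff_mod_2_eq_zero mod_Suc)
    qed
  qed
  \<comment> \<open>\<open>r i\<close> compares the sign of an edge with that of its image. The
    negative edge is used \<open>l - q\<close> times after the winding, plus once if there is a
    winding, so both cycles have the same sign and the product of all \<open>r i\<close> is
    1.\<close>
  define r where "r i = esign C (es ! i) * (if G i = 0 then -1 else 1)" for i
  have r: "r i * r i = 1" if "i < l" for i using sg[OF es(1)[OF that]] by (auto simp: r_def)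
  have "card {i\<in>{..<l}. G i = 0} = (if q = 0 then l else Suc (l - q))"
  proof (cases "q = 0")
    case False
    then have "{i\<in>{..<l}. G i = 0} = insert 0 {q..<l}" using l(1) by (auto simp: G_def)
    then show ?thesis using False by simp
  qed (auto simp: G_def)
  then have "(\<Prod>i<l. if G i = 0 then -1 else 1 :: int) = sign_of C es"
    using q m sC' by (auto simp: prod_sign_card q_def minus_one_power_iff split: if_splits)
  then have r_prod: "(\<Prod>i<l. r i) = 1"
    using sC' by (auto simp: r_def prod.distrib sC)
  \<comment> \<open>Partial products of \<open>r\<close> switch the cycle to the pulled back signs;
    the closing edge fits because the total product is 1. The default 1 keeps \<open>\<tau>\<close>
    a sign off the cycle too.\<close>
  define \<tau> where "\<tau> v = (if v \<in> verts C then (\<Prod>i<iv v. r i) else 1)" for v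
  have r1: "r i \<in> {1, -1}" if "i < l" for i using sg[OF es(1)[OF that]] by (auto simp: r_def)
  have \<tau>1: "(\<Prod>i<j. r i) \<in> {1, -1}" if "j \<le> l" for j
    using that r1 by (intro prod_signs) auto
  have \<tau>_nth: "\<tau> (vs ! i) = (\<Prod>i<i. r i)" if "i < l" for i
    using that iv cov by (auto simp: \<tau>_def l_def)
  have "signed_hom C (neg_cycle m) (\<lambda>v. F (iv v)) (\<lambda>e. G (ie e))"
  proof (rule switching_signed_hom[where \<tau> = \<tau>])
    fix v assume "v \<in> verts C"
    then obtain i where "i < l" "v = vs ! i" using v_ex by blast
    moreover have "F i < m" using q m by (auto simp: F_def intro: less_le_trans[OF mod_less_divisor])
    ultimately show "F (iv v) \<in> verts (neg_cycle m)" by (simp add: iv neg_cycle_def)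
  next
    fix e assume "e \<in> edges C"
    then obtain i where i: "i < l" "e = es ! i" using e_ex by blast
    moreover have "G i < m" using q m by (auto simp: G_def)
    moreover have "Suc i mod l < l" using l by simp
    ultimately show "G (ie e) \<in> edges (neg_cycle m) \<and>
        ends (neg_cycle m) (G (ie e)) = (\<lambda>v. F (iv v)) ` ends C e"
      using step[OF i(1)] by (simp add: ie iv es neg_cycle_def)
  next
    show "\<tau> v = 1 \<or> \<tau> v = -1" for v
      using \<tau>1[of "iv v"] v_ex[of v] iv by (fastforce simp: \<tau>_def)
  next
    fix e u v assume "e \<in> edges C" and uv: "ends C e = {u, v}"
    then obtain i where i: "i < l" "e = es ! i" using e_ex by blast
    then have "{u, v} = {vs ! i, vs ! (Suc i mod l)}" using es uv by auto
    then have "\<tau> u * \<tau> v = \<tau> (vs ! i) * \<tau> (vs ! (Suc i mod l))"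
      by (auto simp: doubleton_eq_iff)
    also have "\<dots> = r i"
    proof (cases "Suc i = l")
      case True
      then have "\<tau> (vs ! i) * \<tau> (vs ! (Suc i mod l)) * r i = 1"
        using r_prod l(1) i by (simp add: \<tau>_nth) (metis prod.lessThan_Suc)
      then show ?thesis using r1[OF i(1)] by auto
    next
      case False
      then have "Suc i < l" using i by simp
      then show ?thesis using i \<tau>1[of i] by (auto simp: \<tau>_nth)
    qed
    finally show "esign (neg_cycle m) (G (ie e)) = \<tau> u * \<tau> v * esign C e"
      using i sg[OF es(1)[OF i(1)]] by (auto simp: ie neg_cycle_def r_def)
  qed
  then show ?thesis by (auto simp: admits_hom_def)
qed

subsection \<open>Antipodal metrics\<close>

text \<open>\<open>p u v s\<close> plays the role of the shortest length of a walk of sign \<open>s\<close> (\<open>True\<close> is negative)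
  from \<open>u\<close> to \<open>v\<close>; equivalently, \<open>p\<close> is a metric on the switching double cover of \<open>V\<close> in which
  antipodal vertices have distance \<open>n\<close>. The function \<open>h\<close> records the parities.\<close>

definition antipodal_metric ::
    "nat \<Rightarrow> 'a set \<Rightarrow> ('a \<Rightarrow> bool) \<Rightarrow> ('a \<Rightarrow> 'a \<Rightarrow> bool \<Rightarrow> nat) \<Rightarrow> bool" where
  "antipodal_metric n V h p \<longleftrightarrow>
     (\<forall>u\<in>V. p u u False = 0 \<and> p u u True = n) \<and>
     (\<forall>u\<in>V. \<forall>v\<in>V. \<forall>s. p u v s = p v u s \<and> (even (p u v s) \<longleftrightarrow> (h u = h v \<longleftrightarrow> s \<longrightarrow> even n))) \<and>
     (\<forall>u\<in>V. \<forall>v\<in>V. \<forall>w\<in>V. \<forall>s t. p u w (s \<noteq> t) \<le> p u v s + p v w t)"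

lemma antipodal_metricD:
  assumes "antipodal_metric n V h p"
  shows "u \<in> V \<Longrightarrow> p u u False = 0" "u \<in> V \<Longrightarrow> p u u True = n"
    and "u \<in> V \<Longrightarrow> v \<in> V \<Longrightarrow> p u v s = p v u s"
    and "u \<in> V \<Longrightarrow> v \<in> V \<Longrightarrow> even (p u v s) \<longleftrightarrow> (h u = h v \<longleftrightarrow> s \<longrightarrow> even n)"
    and "u \<in> V \<Longrightarrow> v \<in> V \<Longrightarrow> w \<in> V \<Longrightarrow> r = (s \<noteq> t) \<Longrightarrow> p u w r \<le> p u v s + p v w t"
  using assms unfolding antipodal_metric_def by blast+

text \<open>Adding a shortcut of sign \<open>a\<close> between \<open>u\<close> and \<open>v\<close>. No geodesic needs to use it twice, by the
  assumption that two antipodal pairs have the same distance.\<close>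

lemma antipodal_metric_shortcut:
  assumes p: "antipodal_metric n V h p" and uv: "u \<in> V" "v \<in> V"
    and gt: "n < p u v a + p u v (\<not> a)" and ge: "2 \<le> p u v a"
  shows "\<exists>p'. antipodal_metric n V h p' \<and> (\<forall>x y s. p' x y s \<le> p x y s) \<and> p' u v a < p u v a"
proof -
  note P = antipodal_metricD[OF p]
  \<comment> \<open>Shortening by exactly 2 preserves parities. For parity reasons the excess over
    \<open>n\<close> is also at least 2, so no antipodal distance drops below
    \<open>n\<close>.\<close>
  define l where "l = p u v a - 2"
  have gt2: "n + 2 \<le> p u v a + p u v (\<not> a)"
  proof -
    have "even (p u v a + p u v (\<not> a)) \<longleftrightarrow> even n"
      using P(4)[OF uv, of a] P(4)[OF uv, of "\<not> a"] by auto
    then show ?thesis using gt by (cases "p u v a + p u v (\<not> a) = Suc n") auto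
  qed
  \<comment> \<open>The candidate lengths use the shortcut at most once, in either direction; the
    sign of the last leg is forced by the other signs.\<close>
  define Q where "Q x y s N \<longleftrightarrow> N = p x y s \<or>
     (\<exists>w z t. (w = u \<and> z = v \<or> w = v \<and> z = u) \<and> N = p x w t + l + p z y (s \<noteq> (t \<noteq> a)))" for x y s N
  define p' where "p' x y s = (LEAST N. Q x y s N)" for x y s
  have Qp': "Q x y s (p' x y s)" for x y s
    unfolding p'_def by (rule LeastI[of _ "p x y s"]) (simp add: Q_def)
  have p'_le: "p' x y s \<le> N" if "Q x y s N" for x y s N
    unfolding p'_def using that by (rule Least_le)
  have le: "p' x y s \<le> p x y s" for x y s by (rule p'_le) (simp add: Q_def)
  have short: "p' x y s \<le> p x w t + l + p z y t'" if "w = u \<and> z = v \<or> w = v \<and> z = u"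
      "s = ((t \<noteq> a) \<noteq> t')" for x y s w z t t'
  proof (rule p'_le)
    have "t' = (s \<noteq> (t \<noteq> a))" using that(2) by auto
    then show "Q x y s (p x w t + l + p z y t')" using that(1) unfolding Q_def by blast
  qed
  have case_p': "(N = p x y s \<Longrightarrow> R) \<Longrightarrow> (\<And>w z t t'. w = u \<and> z = v \<or> w = v \<and> z = u \<Longrightarrow>
        s = ((t \<noteq> a) \<noteq> t') \<Longrightarrow> N = p x w t + l + p z y t' \<Longrightarrow> R) \<Longrightarrow> R"
    if "N = p' x y s" for x y s N R
  proof -
    assume plain: "N = p x y s \<Longrightarrow> R" and shortcut: "\<And>w z t t'. w = u \<and> z = v \<or> w = v \<and> z = u \<Longrightarrow>
        s = ((t \<noteq> a) \<noteq> t') \<Longrightarrow> N = p x w t + l + p z y t' \<Longrightarrow> R"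
    from Qp'[of x y s] that consider "N = p x y s" | w z t where "w = u \<and> z = v \<or> w = v \<and> z = u"
        "N = p x w t + l + p z y (s \<noteq> (t \<noteq> a))"
      unfolding Q_def by blast
    then show R
    proof cases
      case 1 then show R by (rule plain)
    next
      case 2 then show R by (intro shortcut[of w z t "s \<noteq> (t \<noteq> a)"]) auto
    qed
  qed
  have inV: "w \<in> V \<and> z \<in> V" if "w = u \<and> z = v \<or> w = v \<and> z = u" for w z
    using that uv by auto
  have sym_le: "p' y x s \<le> p' x y s" if xy: "x \<in> V" "y \<in> V" for x y s
  proof (rule case_p'[OF refl, of x y s])
    assume "p' x y s = p x y s"
    then show ?thesis using le[of y x s] P(3)[OF xy] by simp
  next
    fix w z t t' assume wz: "w = u \<and> z = v \<or> w = v \<and> z = u" and s: "s = ((t \<noteq> a) \<noteq> t')"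
      and eq: "p' x y s = p x w t + l + p z y t'"
    have "p' y x s \<le> p y z t' + l + p w x t" by (rule short) (use wz s in auto)
    then show ?thesis using P(3)[of y z t'] P(3)[of w x t] inV[OF wz] xy eq by simp
  qed
  have par: "even (p' x y s) \<longleftrightarrow> (h x = h y \<longleftrightarrow> s \<longrightarrow> even n)" if xy: "x \<in> V" "y \<in> V" for x y s
  proof (rule case_p'[OF refl, of x y s])
    assume "p' x y s = p x y s"
    then show ?thesis using P(4)[OF xy] by simp
  next
    fix w z t t' assume wz: "w = u \<and> z = v \<or> w = v \<and> z = u" and s: "s = ((t \<noteq> a) \<noteq> t')"
      and eq: "p' x y s = p x w t + l + p z y t'"
    have "even l \<longleftrightarrow> (h w = h z \<longleftrightarrow> a \<longrightarrow> even n)"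
      using P(4)[OF uv, of a] ge wz by (auto simp: l_def)
    moreover have "even (p x w t) \<longleftrightarrow> (h x = h w \<longleftrightarrow> t \<longrightarrow> even n)"
      and "even (p z y t') \<longleftrightarrow> (h z = h y \<longleftrightarrow> t' \<longrightarrow> even n)"
      using P(4) inV[OF wz] xy by blast+
    ultimately show ?thesis unfolding eq even_add unfolding s by blast
  qed
  have refl_True: "n \<le> p' x x True" if x: "x \<in> V" for x
  proof (rule case_p'[OF refl, of x x True])
    assume "p' x x True = p x x True"
    then show ?thesis using P(2)[OF x] by simp
  next
    fix w z t t' assume wz: "w = u \<and> z = v \<or> w = v \<and> z = u" and s: "True = ((t \<noteq> a) \<noteq> t')"
      and eq: "p' x x True = p x w t + l + p z x t'"
    \<comment> \<open>A negative closed walk through the shortcut returns from \<open>z\<close> to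
      \<open>w\<close> with sign opposite to \<open>a\<close>, which costs at least
      \<open>p u v (\<not> a)\<close>.\<close>
    have "p z w (\<not> a) \<le> p z x t' + p x w t" using inV[OF wz] x s by (intro P(5)) auto
    moreover have "p z w (\<not> a) = p u v (\<not> a)" using wz P(3)[OF uv] by auto
    ultimately show ?thesis using gt2 ge by (simp add: eq l_def)
  qed
  have tri: "p' x z r \<le> p' x y s + p' y z t"
    if xyz: "x \<in> V" "y \<in> V" "z \<in> V" and r: "r = (s \<noteq> t)" for x y z r s t
  proof (rule case_p'[OF refl, of x y s]; rule case_p'[OF refl, of y z t])
    assume "p' x y s = p x y s" "p' y z t = p y z t"
    then show ?thesis using P(5)[OF xyz r] le[of x z r] by simp
  next
    fix w w' c c' assume w: "w = u \<and> w' = v \<or> w = v \<and> w' = u" and t: "t = ((c \<noteq> a) \<noteq> c')"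
      and eq: "p' x y s = p x y s" "p' y z t = p y w c + l + p w' z c'"
    have "p' x z r \<le> p x w (s \<noteq> c) + l + p w' z c'" by (rule short) (use w r t in auto)
    moreover have "p x w (s \<noteq> c) \<le> p x y s + p y w c" using inV[OF w] xyz by (intro P(5)) auto
    ultimately show ?thesis using eq by simp
  next
    fix w w' c c' assume w: "w = u \<and> w' = v \<or> w = v \<and> w' = u" and s: "s = ((c \<noteq> a) \<noteq> c')"
      and eq: "p' x y s = p x w c + l + p w' y c'" "p' y z t = p y z t"
    have "p' x z r \<le> p x w c + l + p w' z (c' \<noteq> t)" by (rule short) (use w r s in auto)
    moreover have "p w' z (c' \<noteq> t) \<le> p w' y c' + p y z t" using inV[OF w] xyz by (intro P(5)) auto
    ultimately show ?thesis using eq by simp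
  next
    fix w w' c c' b b' d d'
    assume w: "w = u \<and> w' = v \<or> w = v \<and> w' = u" and s: "s = ((c \<noteq> a) \<noteq> c')"
      and b: "b = u \<and> b' = v \<or> b = v \<and> b' = u" and t: "t = ((d \<noteq> a) \<noteq> d')"
      and eq: "p' x y s = p x w c + l + p w' y c'" "p' y z t = p y b d + l + p b' z d'"
    define m where "m = (c' \<noteq> d)"
    have r': "r = ((c \<noteq> m) \<noteq> d')" using r s t by (auto simp: m_def)
    note V = inV[OF w] inV[OF b] xyz
    have mid: "p w' b m \<le> p w' y c' + p y b d" using V by (intro P(5)) (auto simp: m_def)
    \<comment> \<open>Two uses reduce to at most one. In the same direction, the middle leg has sign
      \<open>a\<close> and a single shortcut replaces the whole stretch, or it has the other sign
      and, reversed, replaces both shortcuts. In opposite directions, the middle leg runs between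
      two equal or two antipodal points and is moved from \<open>w'\<close> to \<open>w\<close> at
      the same cost.\<close>
    have "p' x z r \<le> p x w c + 2 * l + p w' b m + p b' z d'"
    proof (cases "b = w")
      case True
      then have bb: "b' = w'" using w b by auto
      show ?thesis
      proof (cases "m = a")
        case True
        have "p' x z r \<le> p x w c + l + p w' z d'" by (rule short) (use w r' True in auto)
        then show ?thesis by (simp add: bb)
      next
        case False
        have "p x w' (c \<noteq> m) \<le> p x w c + p w w' m" using V by (intro P(5)) auto
        moreover have "p x z r \<le> p x w' (c \<noteq> m) + p w' z d'" using V r' by (intro P(5)) auto
        moreover have "p w w' m = p w' w m" using V by (intro P(3)) auto
        ultimately show ?thesis using le[of x z r] bb True by simp
      qed
    next
      case False
      then have bb: "b' = w" "b = w'" using w b by auto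
      have "p x z r \<le> p x w (c \<noteq> m) + p w z d'" using V r' by (intro P(5)) auto
      moreover have "p x w (c \<noteq> m) \<le> p x w c + p w w m" using V by (intro P(5)) auto
      moreover have "p w w m = p w' w' m" using V P(1,2) by (cases m) auto
      ultimately show ?thesis using le[of x z r] bb by simp
    qed
    then show ?thesis using eq mid by simp
  qed
  have "p' u v a \<le> l" using short[of u v a False False u v] P(1) uv by simp
  then have "p' u v a < p u v a" using ge by (simp add: l_def)
  moreover have "antipodal_metric n V h p'"
    unfolding antipodal_metric_def
  proof (intro conjI ballI allI)
    show "p' x x False = 0" "p' x x True = n" if "x \<in> V" for x
      using le[of x x False] P(1)[OF that] le[of x x True] P(2)[OF that] refl_True[OF that] by auto
    show "p' x y s = p' y x s" "even (p' x y s) \<longleftrightarrow> (h x = h y \<longleftrightarrow> s \<longrightarrow> even n)" if "x \<in> V" "y \<in> V" for x y s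
      using sym_le par that by (auto intro: le_antisym)
    show "p' x z (s \<noteq> t) \<le> p' x y s + p' y z t" if "x \<in> V" "y \<in> V" "z \<in> V" for x y z s t
      using tri that by blast
  qed
  ultimately show ?thesis using le by blast
qed

text \<open>As long as some pair violates tightness a shortcut can be added, and this strictly
  decreases the finite sum of all distances.\<close>

lemma tight_antipodal_metric_exists:
  assumes n: "2 \<le> n" and V: "finite V" and p: "antipodal_metric n V h p"
  shows "\<exists>q. antipodal_metric n V h q \<and> (\<forall>x y s. q x y s \<le> p x y s) \<and>
     (\<forall>x\<in>V. \<forall>y\<in>V. q x y False + q x y True = n)"
  using p
proof (induction "\<Sum>(x, y, s)\<in>V \<times> V \<times> UNIV. p x y s" arbitrary: p rule: less_induct)
  case less
  note P = antipodal_metricD[OF less.prems]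
  show ?case
  proof (cases "\<forall>x\<in>V. \<forall>y\<in>V. p x y False + p x y True = n")
    case True
    with less.prems show ?thesis by blast
  next
    case False
    then obtain u v where uv: "u \<in> V" "v \<in> V" and ne: "p u v False + p u v True \<noteq> n" by blast
    \<comment> \<open>The triangle inequality through \<open>v\<close> already gives a sum of at
      least \<open>n\<close>, so a violation can only be an excess.\<close>
    have "p u u True \<le> p u v False + p v u True" using uv by (intro P(5)) auto
    then have gt: "n < p u v False + p u v True" using ne P(2)[OF uv(1)] P(3)[OF uv, of True] by simp
    have "\<exists>a. 2 \<le> p u v a"
    proof (rule ccontr)
      assume "\<not> ?thesis"
      then have "p u v False \<le> 1" "p u v True \<le> 1" by (auto simp: not_le less_Suc_eq_le numeral_2_eq_2)
      then show False using gt n by simp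
    qed
    then obtain a where a: "2 \<le> p u v a" by blast
    have "n < p u v a + p u v (\<not> a)" using gt by (cases a) auto
    from antipodal_metric_shortcut[OF less.prems uv this a] obtain p' where
      p': "antipodal_metric n V h p'" "\<And>x y s. p' x y s \<le> p x y s" "p' u v a < p u v a" by blast
    have "(\<Sum>(x, y, s)\<in>V \<times> V \<times> UNIV. p' x y s) < (\<Sum>(x, y, s)\<in>V \<times> V \<times> UNIV. p x y s)"
    proof (rule sum_strict_mono_ex1)
      show "finite (V \<times> V \<times> (UNIV :: bool set))" using V by simp
      show "\<forall>x\<in>V \<times> V \<times> UNIV. (case x of (x, y, s) \<Rightarrow> p' x y s) \<le> (case x of (x, y, s) \<Rightarrow> p x y s)"
        using p'(2) by auto
      show "\<exists>x\<in>V \<times> V \<times> UNIV. (case x of (x, y, s) \<Rightarrow> p' x y s) < (case x of (x, y, s) \<Rightarrow> p x y s)"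
        using uv p'(3) by (intro bexI[of _ "(u, v, a)"]) auto
    qed
    from less.hyps[OF this p'(1)] show ?thesis using p'(2) by (meson order_trans)
  qed
qed

subsection \<open>Embedding 3-trees into hypercubes\<close>

text \<open>The condition for \<open>a\<close>, \<open>b\<close>, \<open>c\<close> to be the
  pairwise distances of three subsets of \<open>{..<n}\<close>. The bound \<open>2 * n\<close>
  arises because a coordinate separates either none or two of the three pairs.\<close>

definition hypercube_triple :: "nat \<Rightarrow> nat \<Rightarrow> nat \<Rightarrow> nat \<Rightarrow> bool" where
  "hypercube_triple n a b c \<longleftrightarrow> even (a + b + c) \<and> a \<le> b + c \<and> b \<le> a + c \<and> c \<le> a + b \<and> a + b + c \<le> 2 * n"

text \<open>Three points split the coordinates into blocks of sizes \<open>p\<close>,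
  \<open>q\<close>, \<open>r\<close>, \<open>s\<close>; the unknowns count the coordinates of each
  block in which a fourth point differs from the first. The three distance equations leave one free
  parameter, confined to an interval that the hypotheses make nonempty.\<close>

lemma four_point_numbers:
  fixes p q r s a b c :: nat
  assumes "hypercube_triple (p + q + r + s) (p + q) a b"
    "hypercube_triple (p + q + r + s) (p + r) a c"
    "hypercube_triple (p + q + r + s) (q + r) b c"
  obtains w x y z where "w \<le> p" "x \<le> q" "y \<le> r" "z \<le> s"
    "w + x + y + z = a" "(p - w) + (q - x) + y + z = b" "(p - w) + (r - y) + x + z = c"
proof -
  \<comment> \<open>The equations force \<open>y + z = U\<close> and
    \<open>x + z = W\<close>.\<close>
  define U where "U = (int a + int b - int p - int q) div 2"
  define W where "W = (int a + int c - int p - int r) div 2"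
  have "even (int a + int b - int p - int q)" "even (int a + int c - int p - int r)"
    using assms(1,2) by (auto simp: hypercube_triple_def)
  then have UW: "2 * U = int a + int b - int p - int q" "2 * W = int a + int c - int p - int r"
    by (auto simp: U_def W_def)
  have I: "a \<le> p + q + b" "b \<le> p + q + a" "p + q \<le> a + b" "a + b \<le> p + q + 2 * (r + s)"
    "a \<le> p + r + c" "c \<le> p + r + a" "p + r \<le> a + c" "a + c \<le> p + r + 2 * (q + s)"
    "b \<le> q + r + c" "c \<le> q + r + b" "q + r \<le> b + c" "b + c \<le> q + r + 2 * (p + s)"
    using assms by (auto simp: hypercube_triple_def)
  \<comment> \<open>The least choice of \<open>z\<close> for which \<open>z\<close> and
    \<open>w\<close> are nonnegative, \<open>y \<le> r\<close> and \<open>x \<le> q\<close>. Of the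
    sixteen comparisons with the upper bounds, four are trivial and the others are the twelve
    inequalities \<open>I\<close>.\<close>
  define t where "t = Max {0, U - int r, W - int q, U + W - int a}"
  have "t \<in> {0, U - int r, W - int q, U + W - int a}" unfolding t_def by (rule Max_in) auto
  moreover have lower: "0 \<le> t" "U - int r \<le> t" "W - int q \<le> t" "U + W - int a \<le> t"
    unfolding t_def by (auto intro!: Max_ge)
  ultimately have upper: "t \<le> int s" "t \<le> U" "t \<le> W" "t \<le> U + W - int a + int p"
    using UW I by (elim insertE emptyE; simp; linarith)+
  obtain w where w: "int w = int a - U - W + t" using lower(4) by (intro that[of "nat (int a - U - W + t)"]) simp
  obtain x where x: "int x = W - t" using upper(3) by (intro that[of "nat (W - t)"]) simp
  obtain y where y: "int y = U - t" using upper(2) by (intro that[of "nat (U - t)"]) simp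
  obtain z where z: "int z = t" using lower(1) by (intro that[of "nat t"]) simp
  have le: "w \<le> p" "x \<le> q" "y \<le> r" "z \<le> s"
    using w x y z lower upper by linarith+
  have "w + x + y + z = a" using w x y z by linarith
  moreover have "(p - w) + (q - x) + y + z = b" "(p - w) + (r - y) + x + z = c"
    using w x y z UW le by linarith+
  ultimately show ?thesis using that le by blast
qed

text \<open>The distances from \<open>X\<close> to the three sets depend only on how many elements
  of each block \<open>X\<close> flips relative to \<open>A\<close>, so the existence of
  \<open>X\<close> is a matter of numbers.\<close>

lemma three_point_extension:
  fixes A B C :: "nat set"
  assumes sub: "A \<subseteq> {..<n}" "B \<subseteq> {..<n}" "C \<subseteq> {..<n}"
    and "hypercube_triple n (card (sym_diff A B)) a b"
    and "hypercube_triple n (card (sym_diff A C)) a c"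
    and "hypercube_triple n (card (sym_diff B C)) b c"
  shows "\<exists>X \<subseteq> {..<n}. card (sym_diff X A) = a \<and> card (sym_diff X B) = b \<and> card (sym_diff X C) = c"
proof -
  define B' C' where "B' = sym_diff A B" and "C' = sym_diff A C"
  \<comment> \<open>\<open>A\<close> is the odd one out on \<open>P\<close>, \<open>B\<close> on
    \<open>Q\<close> and \<open>C\<close> on \<open>R\<close>; all three agree on
    \<open>S\<close>.\<close>
  define P Q R S where "P = B' \<inter> C'" and "Q = B' - C'" and "R = C' - B'" and "S = {..<n} - (B' \<union> C')"
  have B'C': "B' \<subseteq> {..<n}" "C' \<subseteq> {..<n}" using sub by (auto simp: B'_def C'_def)
  then have fin: "finite P" "finite Q" "finite R" "finite S"
    using B'C'[THEN finite_subset] by (auto simp: P_def Q_def R_def S_def)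
  have dj: "P \<inter> Q = {}" "P \<inter> R = {}" "P \<inter> S = {}" "Q \<inter> R = {}" "Q \<inter> S = {}" "R \<inter> S = {}"
    by (auto simp: P_def Q_def R_def S_def)
  have un4: "card (I \<union> J \<union> K \<union> L) = card I + card J + card K + card L"
    if "I \<subseteq> P" "J \<subseteq> Q" "K \<subseteq> R" "L \<subseteq> S" for I J K L
  proof -
    have "finite I" "finite J" "finite K" "finite L" using that fin finite_subset by blast+
    moreover have "I \<inter> J = {}" "(I \<union> J) \<inter> K = {}" "(I \<union> J \<union> K) \<inter> L = {}" using that dj by blast+
    ultimately show ?thesis by (simp add: card_Un_disjoint)
  qed
  have BC: "B' = P \<union> Q" "C' = P \<union> R" "sym_diff B C = Q \<union> R"
    by (auto simp: P_def Q_def R_def B'_def C'_def)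
  have "{..<n} = P \<union> Q \<union> R \<union> S" using B'C' by (auto simp: P_def Q_def R_def S_def)
  then have n: "n = card P + card Q + card R + card S"
    using un4[of P Q R S] by (metis card_lessThan order_refl)
  have cards: "card (sym_diff A B) = card P + card Q" "card (sym_diff A C) = card P + card R"
      "card (sym_diff B C) = card Q + card R"
    unfolding BC(3) B'_def[symmetric] C'_def[symmetric] BC(1,2)
    using un4[of P Q "{}" "{}"] un4[of P "{}" R "{}"] un4[of "{}" Q R "{}"] by simp_all
  obtain w x y z where wxyz: "w \<le> card P" "x \<le> card Q" "y \<le> card R" "z \<le> card S"
    "w + x + y + z = a" "(card P - w) + (card Q - x) + y + z = b"
    "(card P - w) + (card R - y) + x + z = c"
    by (rule four_point_numbers[OF assms(4-6)[unfolded cards n]])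
  obtain P1 Q1 R1 S1 where sub1: "P1 \<subseteq> P" "Q1 \<subseteq> Q" "R1 \<subseteq> R" "S1 \<subseteq> S"
    and card1: "card P1 = w" "card Q1 = x" "card R1 = y" "card S1 = z"
    using wxyz(1-4) by (meson obtain_subset_with_card_n)
  have fin1: "finite P1" "finite Q1" "finite R1" "finite S1"
    using sub1 fin finite_subset by blast+
  define X where "X = sym_diff A (P1 \<union> Q1 \<union> R1 \<union> S1)"
  have cd: "card (P - P1) = card P - w" "card (Q - Q1) = card Q - x" "card (R - R1) = card R - y"
    using sub1 fin1 card1 by (simp_all add: card_Diff_subset)
  have "sym_diff X A = P1 \<union> Q1 \<union> R1 \<union> S1" by (auto simp: X_def)
  then have 1: "card (sym_diff X A) = a" using un4[OF sub1] card1 wxyz(5) by simp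
  have "sym_diff X B = sym_diff B' (P1 \<union> Q1 \<union> R1 \<union> S1)" unfolding X_def B'_def by blast
  also have "\<dots> = (P - P1) \<union> (Q - Q1) \<union> R1 \<union> S1"
    unfolding BC(1) using sub1 dj by blast
  finally have 2: "card (sym_diff X B) = b" using un4[of "P - P1" "Q - Q1" R1 S1] sub1 cd card1 wxyz(6) by auto
  have "sym_diff X C = sym_diff C' (P1 \<union> Q1 \<union> R1 \<union> S1)" unfolding X_def C'_def by blast
  also have "\<dots> = (P - P1) \<union> Q1 \<union> (R - R1) \<union> S1"
    unfolding BC(2) using sub1 dj by blast
  finally have 3: "card (sym_diff X C) = c" using un4[of "P - P1" Q1 "R - R1" S1] sub1 cd card1 wxyz(7) by auto
  have "X \<subseteq> {..<n}" using sub sub1 B'C' by (auto simp: X_def P_def Q_def R_def S_def)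
  with 1 2 3 show ?thesis by blast
qed

section \<open>Embedding a 3-tree vertex by vertex\<close>

lemma three_tree_wf: "three_tree V E \<Longrightarrow> finite V \<and> (\<forall>e\<in>E. e \<subseteq> V \<and> card e = 2)"
proof (induction rule: three_tree.induct)
  case (K4 V)
  then have "finite V" by (intro card_ge_0_finite) simp
  then show ?case by simp
next
  case (add_vertex V E v T)
  have "card {v, t} = 2" if "t \<in> T" for t using that add_vertex.hyps by (auto simp: card_insert_if)
  then show ?case using add_vertex by auto
qed

text \<open>A new vertex is joined to a triangle whose edges already have the right lengths, so
  \<open>three_point_extension\<close> places it. Only distances along edges of the 3-tree are
  controlled.\<close>

lemma three_tree_hypercube_embedding:
  fixes D :: "'a \<Rightarrow> 'a \<Rightarrow> nat"
  assumes "three_tree V E"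
    and "\<And>x. x \<in> V \<Longrightarrow> D x x = 0" and "\<And>x y. x \<in> V \<Longrightarrow> y \<in> V \<Longrightarrow> D x y = D y x"
    and "\<And>x y z. x \<in> V \<Longrightarrow> y \<in> V \<Longrightarrow> z \<in> V \<Longrightarrow> hypercube_triple n (D x y) (D x z) (D y z)"
  shows "\<exists>F. (\<forall>v\<in>V. F v \<subseteq> {..<n}) \<and>
     (\<forall>x y. {x, y} \<in> E \<longrightarrow> card (sym_diff (F x) (F y)) = D x y)"
  using assms
proof (induction rule: three_tree.induct)
  case (K4 V)
  obtain a b c d where V: "V = {a, b, c, d}" "distinct [a, b, c, d]"
  proof -
    from K4.hyps obtain a V1 where "V = insert a V1" "a \<notin> V1" "card V1 = 3"
      using card_Suc_eq[of V 3] by auto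
    moreover from this(3) obtain b c d where "V1 = {b, c, d}" "b \<noteq> c" "c \<noteq> d" "b \<noteq> d"
      using card_3_iff by metis
    ultimately show ?thesis by (intro that[of a b c d]) auto
  qed
  have Vin: "a \<in> V" "b \<in> V" "c \<in> V" "d \<in> V" using V by auto
  note D = K4.prems(1) K4.prems(2)
  note T = K4.prems(3)
  have tr: "hypercube_triple n (D x y) (D v x) (D v y)" if "x \<in> V" "y \<in> V" "v \<in> V" for x y v
    using T[of x y v] D that by simp
  have triv: "sym_diff A A = {}" for A :: "nat set" by auto
  \<comment> \<open>The first point is the empty set. While fewer than three points are placed, the
    extension lemma is applied with repeated points.\<close>
  have "\<exists>X \<subseteq> {..<n}. card (sym_diff X {}) = D b a \<and> card (sym_diff X {}) = D b a \<and> card (sym_diff X {}) = D b a"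
    by (rule three_point_extension) (use tr[of a a b] D Vin in simp_all)
  then obtain B where B: "B \<subseteq> {..<n}" "card (sym_diff B {}) = D b a" by blast
  have AB: "card (sym_diff {} B) = D a b" using B(2) D Vin by (simp add: Un_commute)
  have "\<exists>X \<subseteq> {..<n}. card (sym_diff X {}) = D c a \<and> card (sym_diff X B) = D c b \<and> card (sym_diff X B) = D c b"
    by (rule three_point_extension) (use tr[of a b c] tr[of b b c] D Vin B AB triv in \<open>simp_all\<close>)
  then obtain C where C: "C \<subseteq> {..<n}" "card (sym_diff C {}) = D c a" "card (sym_diff C B) = D c b" by blast
  have AC: "card (sym_diff {} C) = D a c" using C(2) D Vin by (simp add: Un_commute)
  have BC: "card (sym_diff B C) = D b c" using C(3) D Vin by (simp add: Un_commute)
  have "\<exists>X \<subseteq> {..<n}. card (sym_diff X {}) = D d a \<and> card (sym_diff X B) = D d b \<and> card (sym_diff X C) = D d c"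
    by (rule three_point_extension) (use tr[of a b d] tr[of a c d] tr[of b c d] Vin B C AB AC BC in \<open>simp_all\<close>)
  then obtain X where X: "X \<subseteq> {..<n}" "card (sym_diff X {}) = D d a" "card (sym_diff X B) = D d b"
      "card (sym_diff X C) = D d c" by blast
  define F where "F x = (if x = a then {} else if x = b then B else if x = c then C else X)" for x
  have F: "F a = {}" "F b = B" "F c = C" "F d = X" using V by (auto simp: F_def)
  have half: "card (sym_diff (F x) (F y)) = D x y" if "(x, y) \<in> {(b, a), (c, a), (c, b), (d, a), (d, b), (d, c)}" for x y
    using that B C X by (auto simp: F)
  have "card (sym_diff (F x) (F y)) = D x y" if "x \<in> V" "y \<in> V" "x \<noteq> y" for x y
  proof -
    have "(x, y) \<in> {(b, a), (c, a), (c, b), (d, a), (d, b), (d, c)} \<or> (y, x) \<in> {(b, a), (c, a), (c, b), (d, a), (d, b), (d, c)}"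
      using that V(1) by auto
    then show ?thesis using half[of x y] half[of y x] D(2)[OF that(1,2)] by (auto simp only: Un_commute)
  qed
  moreover have "x \<in> V \<and> y \<in> V \<and> x \<noteq> y" if "{x, y} \<subseteq> V \<and> card {x, y} = 2" for x y
    using that by (cases "x = y") auto
  moreover have "\<forall>v\<in>V. F v \<subseteq> {..<n}" using V F B C X by auto
  ultimately show ?case by blast
next
  case (add_vertex V E v T)
  have "\<exists>F. (\<forall>v\<in>V. F v \<subseteq> {..<n}) \<and> (\<forall>x y. {x, y} \<in> E \<longrightarrow> card (sym_diff (F x) (F y)) = D x y)"
    by (rule add_vertex.IH) (use add_vertex.prems in auto)
  then obtain F where F: "\<And>v. v \<in> V \<Longrightarrow> F v \<subseteq> {..<n}"
    "\<And>x y. {x, y} \<in> E \<Longrightarrow> card (sym_diff (F x) (F y)) = D x y" by blast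
  obtain a b c where T: "T = {a, b, c}" "a \<noteq> b" "a \<noteq> c" "b \<noteq> c"
    using add_vertex.hyps card_3_iff by metis
  have Vin: "a \<in> V" "b \<in> V" "c \<in> V" using T add_vertex.hyps by auto
  have "{a, b} \<in> E" "{a, c} \<in> E" "{b, c} \<in> E" using T add_vertex.hyps by auto
  note Fabc = this[THEN F(2)]
  have tr: "hypercube_triple n (D x y) (D v x) (D v y)" if "x \<in> V" "y \<in> V" for x y
    using add_vertex.prems(3)[of x y v] add_vertex.prems(2)[of x v] add_vertex.prems(2)[of y v] that by simp
  have "\<exists>X \<subseteq> {..<n}. card (sym_diff X (F a)) = D v a \<and> card (sym_diff X (F b)) = D v b \<and> card (sym_diff X (F c)) = D v c"
    by (rule three_point_extension) (use F(1) Fabc tr Vin in simp_all)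
  then obtain X where X: "X \<subseteq> {..<n}" "\<And>t. t \<in> T \<Longrightarrow> card (sym_diff X (F t)) = D v t"
    using T by blast
  have wf: "e \<subseteq> V" if "e \<in> E" for e using three_tree_wf[OF add_vertex.hyps(1)] that by blast
  define F' where "F' = F(v := X)"
  have F': "F' v = X" "\<And>x. x \<in> V \<Longrightarrow> F' x = F x" using add_vertex.hyps by (auto simp: F'_def)
  have "card (sym_diff (F' x) (F' y)) = D x y" if xy: "{x, y} \<in> E \<union> {{v, t} |t. t \<in> T}" for x y
  proof (cases "{x, y} \<in> E")
    case True
    then have "F' x = F x" "F' y = F y" using wf F' by auto
    then show ?thesis using True F(2) by simp
  next
    case False
    then obtain t where t: "t \<in> T" "{x, y} = {v, t}" using xy by blast
    have tV: "t \<in> V" using t add_vertex.hyps by auto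
    from t(2) consider "x = v" "y = t" | "x = t" "y = v" by (auto simp: doubleton_eq_iff)
    then show ?thesis
    proof cases
      case 1 then show ?thesis using X t F' tV by simp
    next
      case 2
      then have "card (sym_diff (F' x) (F' y)) = card (sym_diff X (F t))" using F' tV by (simp add: Un_commute)
      then show ?thesis using X t 2 tV add_vertex.prems(2)[of t v] by simp
    qed
  qed
  moreover have "\<forall>x\<in>insert v V. F' x \<subseteq> {..<n}" using F(1) X F' by auto
  ultimately show ?case by blast
qed

subsection \<open>The walk metric of a signed graph\<close>

locale simple_signed_graph =
  fixes G :: "('v, 'e) sgraph"
  assumes signed_graph: "signed_graph G"
    and inj_ends: "inj_on (ends G) (edges G)"
    and card_ends: "e \<in> edges G \<Longrightarrow> card (ends G e) = 2"
begin

definition adj :: "'v \<Rightarrow> 'v \<Rightarrow> bool" where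
  "adj u v \<longleftrightarrow> (\<exists>e \<in> edges G. ends G e = {u, v})"

definition edge :: "'v \<Rightarrow> 'v \<Rightarrow> 'e" where
  "edge u v = (THE e. e \<in> edges G \<and> ends G e = {u, v})"

definition neg :: "'v \<Rightarrow> 'v \<Rightarrow> bool" where
  "neg u v \<longleftrightarrow> esign G (edge u v) = -1"

lemma edge_eq: "e \<in> edges G \<Longrightarrow> ends G e = {u, v} \<Longrightarrow> edge u v = e"
  unfolding edge_def using inj_ends by (intro the_equality) (auto simp: inj_on_def)

lemma edge: assumes "adj u v" shows "edge u v \<in> edges G" "ends G (edge u v) = {u, v}"
  using assms edge_eq by (auto simp: adj_def)

lemma adj_sym: "adj u v \<Longrightarrow> adj v u"
  by (simp add: adj_def insert_commute)

lemma edge_sym: "edge u v = edge v u"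
  by (simp add: edge_def insert_commute)

lemma neg_sym: "neg u v = neg v u"
  by (simp add: neg_def edge_sym)

lemma adj_neq: "adj u v \<Longrightarrow> u \<noteq> v"
  using card_ends by (force simp: adj_def)

lemma adj_verts: "adj u v \<Longrightarrow> u \<in> verts G \<and> v \<in> verts G"
  using signed_graph by (auto simp: adj_def signed_graph_def)

lemma esign_edge: "adj u v \<Longrightarrow> esign G (edge u v) = (if neg u v then -1 else 1)"
  using signed_graph edge(1) by (fastforce simp: neg_def signed_graph_def)

text \<open>Since the graph is simple, a walk is determined by the list of its vertices.\<close>

fun walk :: "'v list \<Rightarrow> bool" where
  "walk (u # v # xs) \<longleftrightarrow> adj u v \<and> walk (v # xs)"
| "walk _ \<longleftrightarrow> True"

fun walk_neg :: "'v list \<Rightarrow> bool" where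
  "walk_neg (u # v # xs) \<longleftrightarrow> neg u v \<noteq> walk_neg (v # xs)"
| "walk_neg _ \<longleftrightarrow> False"

lemma walk_append: "walk (xs @ v # ys) \<longleftrightarrow> walk (xs @ [v]) \<and> walk (v # ys)"
  by (induction xs rule: walk.induct) (auto split: list.splits intro: walk.elims)

lemma walk_neg_append: "walk_neg (xs @ v # ys) \<longleftrightarrow> walk_neg (xs @ [v]) \<noteq> walk_neg (v # ys)"
  by (induction xs rule: walk.induct) (auto split: list.splits)

lemma prod_list_walk:
  "walk (x # xs @ [y]) \<Longrightarrow>
     prod_list (map (esign G) (map2 edge (x # xs) (xs @ [y]))) = (if walk_neg (x # xs @ [y]) then -1 else 1)"
  by (induction xs arbitrary: x) (auto simp: esign_edge)

lemma walk_nth: "walk xs \<Longrightarrow> Suc i < length xs \<Longrightarrow> adj (xs ! i) (xs ! Suc i)"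
proof (induction xs arbitrary: i rule: walk.induct)
  case (1 u v xs)
  then show ?case by (cases i) auto
qed auto

text \<open>Equal edges at different positions would make each position the cyclic successor of the
  other, which is impossible with at least three vertices.\<close>

lemma closed_walk_cycle_in:
  assumes "walk (x # xs @ [x])" and "distinct (x # xs)" and "2 \<le> length xs"
  shows "cycle_in G (x # xs) (map2 edge (x # xs) (xs @ [x]))"
proof -
  define vs where "vs = x # xs"
  define l where "l = length vs"
  have l: "3 \<le> l" using assms(3) by (simp add: l_def vs_def)
  have rot: "xs @ [x] = rotate1 vs" by (simp add: vs_def)
  define es where "es = map2 edge vs (rotate1 vs)"
  have es_nth: "es ! i = edge (vs ! i) (vs ! (Suc i mod l))" if "i < l" for i
    using that by (simp add: es_def l_def nth_rotate1)
  have adj: "adj (vs ! i) (vs ! (Suc i mod l))" if i: "i < l" for i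
  proof -
    have "adj ((x # xs @ [x]) ! i) ((x # xs @ [x]) ! Suc i)"
      using i by (intro walk_nth assms) (simp add: l_def vs_def)
    moreover have "(x # xs @ [x]) ! i = vs ! i"
      using i nth_append[of vs "[x]" i] by (simp add: l_def vs_def)
    moreover have "(x # xs @ [x]) ! Suc i = vs ! (Suc i mod l)"
      using i nth_rotate1[of i vs] by (simp add: l_def rot)
    ultimately show ?thesis by simp
  qed
  have dv: "distinct vs" using assms(2) by (simp add: vs_def)
  have len: "length es = l" by (simp add: es_def l_def)
  have "distinct es"
    unfolding distinct_conv_nth
  proof (intro allI impI)
    fix i j assume ij: "i < length es" "j < length es" "i \<noteq> j"
    show "es ! i \<noteq> es ! j"
    proof
      assume "es ! i = es ! j"
      then have "{vs ! i, vs ! (Suc i mod l)} = {vs ! j, vs ! (Suc j mod l)}"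
        using edge(2)[OF adj] es_nth ij len by metis
      moreover have "Suc i mod l < l" "Suc j mod l < l" using l by simp_all
      ultimately have i: "i = Suc j mod l" and j: "j = Suc i mod l"
        using ij dv len by (auto simp: doubleton_eq_iff nth_eq_iff_index_eq l_def)
      show False
      proof (cases "Suc i = l \<or> Suc j = l")
        case True
        then show False
        proof
          assume *: "Suc i = l"
          then have "j = 0" using j by (metis mod_self)
          moreover have "Suc 0 mod l = 1" using l by simp
          ultimately have "i = 1" using i by metis
          with * l show False by simp
        next
          assume *: "Suc j = l"
          then have "i = 0" using i by (metis mod_self)
          moreover have "Suc 0 mod l = 1" using l by simp
          ultimately have "j = 1" using j by metis
          with * l show False by simp
        qed
      next
        case False
        then have "Suc i < l" "Suc j < l" using ij len by auto
        then have "Suc i mod l = Suc i" "Suc j mod l = Suc j" by simp_all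
        then show False using i j by linarith
      qed
    qed
  qed
  moreover have "set es \<subseteq> edges G"
    using edge(1)[OF adj] es_nth len by (auto simp: in_set_conv_nth)
  moreover have "set vs \<subseteq> verts G"
    using adj_verts[OF adj] by (auto simp: in_set_conv_nth l_def)
  moreover have "\<forall>i<l. ends G (es ! i) = {vs ! i, vs ! (Suc i mod l)}"
    using edge(2)[OF adj] es_nth by metis
  moreover have "vs \<noteq> []" by (simp add: vs_def)
  ultimately have "cycle_in G vs es"
    using dv len unfolding cycle_in_def l_def[symmetric] by (intro conjI)
  then show ?thesis unfolding es_def rot[symmetric] unfolding vs_def .
qed

text \<open>Walks are remembered only by their ends, sign and length. Negative is
  \<open>True\<close>, so signs multiply by exclusive or.\<close>

inductive conn :: "'v \<Rightarrow> 'v \<Rightarrow> bool \<Rightarrow> nat \<Rightarrow> bool" where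
  conn_refl: "u \<in> verts G \<Longrightarrow> conn u u False 0"
| conn_step: "conn u v s l \<Longrightarrow> adj v w \<Longrightarrow> r = (s \<noteq> neg v w) \<Longrightarrow> conn u w r (Suc l)"

lemma conn_verts: "conn u v s l \<Longrightarrow> u \<in> verts G \<and> v \<in> verts G"
  by (induction rule: conn.induct) (auto dest: adj_verts)

lemma conn_edge: "adj u v \<Longrightarrow> conn u v (neg u v) 1"
  using conn_step[OF conn_refl] adj_verts[of u v] by simp

lemma conn_trans:
  assumes "conn u v s l" "conn v w t m" shows "conn u w (s \<noteq> t) (l + m)"
  using assms(2,1)
proof (induction rule: conn.induct)
  case (conn_step v w' t m w r)
  then have "conn u w ((s \<noteq> t) \<noteq> neg w' w) (Suc (l + m))" by (intro conn.conn_step) auto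
  moreover have "((s \<noteq> t) \<noteq> neg w' w) = (s \<noteq> r)" using conn_step.hyps by auto
  ultimately show ?case by (simp only: add_Suc_right)
qed auto

lemma conn_sym: "conn u v s l \<Longrightarrow> conn v u s l"
proof (induction rule: conn.induct)
  case (conn_step u v s l w r)
  have "conn w u (neg w v \<noteq> s) (1 + l)"
    using conn_edge[OF adj_sym] conn_step conn_trans by blast
  moreover have "(neg w v \<noteq> s) = r" using conn_step.hyps neg_sym by auto
  ultimately show ?case by simp
qed (rule conn_refl)

end

section \<open>Graphs all of whose cycles are admissible\<close>

locale admissible_graph = simple_signed_graph G
  for G :: "('v, 'e) sgraph" +
  fixes n :: nat
  assumes n: "2 \<le> n" and fin: "finite (verts G)"
    and cycles: "\<And>vs es. cycle_in G vs es \<Longrightarrow> admissible n (length vs) (sign_of G es)"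
begin

text \<open>Shortening a walk to a path removes admissible cycles one by one.\<close>

lemma conn_path:
  assumes "conn u v s l"
  shows "\<exists>xs. walk (v # xs) \<and> distinct (v # xs) \<and> last (v # xs) = u \<and> length xs \<le> l \<and>
     (even (l + length xs) \<longleftrightarrow> (s = walk_neg (v # xs) \<or> even n)) \<and>
     (s \<noteq> walk_neg (v # xs) \<longrightarrow> n + length xs \<le> l)"
  using assms
proof (induction rule: conn.induct)
  case (conn_refl u)
  show ?case by (rule exI[of _ "[]"]) simp
next
  case (conn_step u v s l w r)
  then obtain xs where xs: "walk (v # xs)" "distinct (v # xs)" "last (v # xs) = u" "length xs \<le> l"
    "even (l + length xs) \<longleftrightarrow> (s = walk_neg (v # xs) \<or> even n)"
    "s \<noteq> walk_neg (v # xs) \<longrightarrow> n + length xs \<le> l" by blast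
  show ?case
  proof (cases "w \<in> set (v # xs)")
    case False
    then show ?thesis using xs conn_step.hyps adj_sym[of v w] neg_sym[of v w]
      by (intro exI[of _ "v # xs"]) auto
  next
    case True
    moreover have "w \<noteq> v" using adj_neq conn_step.hyps by blast
    \<comment> \<open>The path is listed from its current end \<open>v\<close> back to
      \<open>u\<close>. A step to a vertex \<open>w\<close> on it closes the segment
      \<open>w, v, ys\<close>, which is cut out; \<open>w # zs\<close> remains.\<close>
    ultimately obtain ys zs where "xs = ys @ w # zs" by (auto dest: split_list)
    then have split: "v # xs = (v # ys) @ w # zs" by simp
    define b where "b = walk_neg (w # (v # ys) @ [w])"
    have cw: "walk (w # (v # ys) @ [w])"
      using xs(1) walk_append[of "v # ys" w zs] adj_sym[OF conn_step.hyps(2)] unfolding split by simp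
    have wn: "walk_neg (v # xs) = ((b \<noteq> neg v w) \<noteq> walk_neg (w # zs))"
      unfolding split b_def using walk_neg_append[of "v # ys" w zs] neg_sym[of v w] by auto
    have adm: "(even (length ys + 2) \<longleftrightarrow> \<not> b \<or> even n) \<and> (b \<longrightarrow> n \<le> length ys + 2)"
    \<comment> \<open>With \<open>ys\<close> empty the step retraces an edge. This is not a cycle,
      but as a positive closed walk of length 2 it meets the same conditions.\<close>
    proof (cases "ys = []")
      case True
      then show ?thesis using neg_sym[of v w] by (simp add: b_def)
    next
      case False
      have d: "distinct (w # v # ys)" using xs(2) split by auto
      have cyc: "cycle_in G (w # (v # ys)) (map2 edge (w # (v # ys)) ((v # ys) @ [w]))"
        by (rule closed_walk_cycle_in) (use cw d False in \<open>auto simp: Suc_le_eq\<close>)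
      have "sign_of G (map2 edge (w # (v # ys)) ((v # ys) @ [w])) = (if b then -1 else 1)"
        unfolding sign_of_def b_def using cw by (rule prod_list_walk)
      with cycles[OF cyc] have "admissible n (length ys + 2) (if b then -1 else 1)" by simp
      then show ?thesis by (auto simp: admissible_def split: if_splits)
    qed
    have len: "length xs = length ys + 1 + length zs" using split by simp
    have "walk (w # zs)" using xs(1) walk_append[of "v # ys" w zs] unfolding split by simp
    moreover have "distinct (w # zs)" "last (w # zs) = u" using xs(2,3) split by auto
    moreover have "length zs \<le> Suc l" using xs(4) len by simp
    moreover have r: "r = (s \<noteq> neg v w)" by fact
    have diff: "(r \<noteq> walk_neg (w # zs)) = ((s \<noteq> walk_neg (v # xs)) \<noteq> b)"
      unfolding wn r by auto
    have "even (Suc l + length zs) \<longleftrightarrow> even ((l + length xs) + (length ys + 2))"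
      using len by auto
    then have "even (Suc l + length zs) \<longleftrightarrow> (r = walk_neg (w # zs) \<or> even n)"
      using xs(5) adm diff unfolding even_add[of "l + length xs"] by blast
    moreover have "r \<noteq> walk_neg (w # zs) \<longrightarrow> n + length zs \<le> Suc l"
      using diff xs(4,6) adm len by (cases b) auto
    ultimately show ?thesis by blast
  qed
qed

text \<open>The path left over from a closed walk is trivial, so its length and sign come entirely
  from the pieces removed.\<close>

lemma conn_closed:
  assumes "conn u u s l"
  shows "even l \<longleftrightarrow> \<not> s \<or> even n" and "s \<Longrightarrow> n \<le> l"
proof -
  from conn_path[OF assms] obtain xs where xs: "distinct (u # xs)" "last (u # xs) = u"
    "even (l + length xs) \<longleftrightarrow> (s = walk_neg (u # xs) \<or> even n)"
    "s \<noteq> walk_neg (u # xs) \<longrightarrow> n + length xs \<le> l" by blast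
  then have "xs = []" by (metis distinct.simps(2) last_ConsR last_in_set)
  then show "even l \<longleftrightarrow> \<not> s \<or> even n" "s \<Longrightarrow> n \<le> l" using xs by auto
qed

text \<open>By \<open>conn_closed\<close>, all walks between two given vertices agree on the parity
  of their length corrected by their sign. Its value from a root of the component defines
  \<open>h\<close>.\<close>

lemma parity_potential:
  "\<exists>h :: 'v \<Rightarrow> bool. \<forall>u v s l. conn u v s l \<longrightarrow> (even l \<longleftrightarrow> (h u = h v \<longleftrightarrow> s \<longrightarrow> even n))"
proof -
  \<comment> \<open>Connected vertices satisfy the same choice predicate, hence get the same
    root.\<close>
  define root where "root v = (SOME r. \<exists>s l. conn r v s l)" for v
  define h where "h v = (\<exists>s l. conn (root v) v s l \<and> (even l \<longleftrightarrow> (s \<longrightarrow> even n)))" for v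
  have root: "\<exists>s l. conn (root v) v s l" if "v \<in> verts G" for v
    unfolding root_def by (rule someI[of _ v]) (use conn_refl[OF that] in blast)
  have h: "h v \<longleftrightarrow> (even l \<longleftrightarrow> (s \<longrightarrow> even n))" if c: "conn (root v) v s l" for v s l
  proof -
    have "(even l' \<longleftrightarrow> (s' \<longrightarrow> even n)) \<longleftrightarrow> (even l \<longleftrightarrow> (s \<longrightarrow> even n))" if c': "conn (root v) v s' l'" for s' l'
      using conn_closed(1)[OF conn_trans[OF c conn_sym[OF c']]] by auto
    then show ?thesis using c unfolding h_def by blast
  qed
  have "even l \<longleftrightarrow> (h u = h v \<longleftrightarrow> s \<longrightarrow> even n)" if c: "conn u v s l" for u v s l
  proof -
    have "(\<exists>s l. conn r u s l) = (\<exists>s l. conn r v s l)" for r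
      using conn_trans c conn_sym[OF c] by blast
    then have eq: "root u = root v" by (simp add: root_def)
    obtain t m where t: "conn (root u) u t m" using root conn_verts[OF c] by blast
    have "conn (root v) v (t \<noteq> s) (m + l)" using conn_trans[OF t c] eq by simp
    from h[OF this] h[OF t] show ?thesis by auto
  qed
  note potential = this
  show ?thesis by (intro exI[of _ h] allI impI potential)
qed

text \<open>Extra connections of length at least \<open>n\<close> make all distances finite without creating a
  short negative closed walk.\<close>

lemma antipodal_metric_exists:
  obtains h p where "antipodal_metric n (verts G) h p" "\<And>u v. adj u v \<Longrightarrow> p u v (neg u v) = 1"
proof -
  from parity_potential obtain h :: "'v \<Rightarrow> bool" where
    "\<forall>u v s l. conn u v s l \<longrightarrow> (even l \<longleftrightarrow> (h u = h v \<longleftrightarrow> s \<longrightarrow> even n))" ..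
  note h = this[rule_format]
  define R where "R u v s l \<longleftrightarrow> conn u v s l \<or>
      n \<le> l \<and> (even l \<longleftrightarrow> (h u = h v \<longleftrightarrow> s \<longrightarrow> even n))" for u v s l
  define p where "p u v s = (LEAST l. R u v s l)" for u v s
  have R_par: "even l \<longleftrightarrow> (h u = h v \<longleftrightarrow> s \<longrightarrow> even n)" if "R u v s l" for u v s l
    using that h by (auto simp: R_def)
  \<comment> \<open>One of \<open>n\<close> and \<open>Suc n\<close> has the required
    parity.\<close>
  have "\<exists>l. R u v s l" for u v s
  proof -
    have "even n \<noteq> even (Suc n)" "n \<le> n" "n \<le> Suc n" by simp_all
    then show ?thesis unfolding R_def by blast
  qed
  then have Rp: "R u v s (p u v s)" for u v s
    unfolding p_def by (rule LeastI_ex)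
  have p_le: "p u v s \<le> l" if "R u v s l" for u v s l
    unfolding p_def using that by (rule Least_le)
  have R_sym: "R u v s l \<Longrightarrow> R v u s l" for u v s l
    unfolding R_def using conn_sym by auto
  have R_trans: "R u w (s \<noteq> t) (l + m)" if "R u v s l" "R v w t m" for u v w s t l m
  proof (cases "conn u v s l \<and> conn v w t m")
    case True
    then show ?thesis unfolding R_def using conn_trans by blast
  next
    case False
    \<comment> \<open>A composite with an extra part is itself long enough to count as an extra
      connection.\<close>
    then have "n \<le> l + m" using that by (auto simp: R_def)
    moreover have "even (l + m) \<longleftrightarrow> (h u = h w \<longleftrightarrow> (s \<noteq> t) \<longrightarrow> even n)"
      using R_par[OF that(1)] R_par[OF that(2)] unfolding even_add by blast
    ultimately show ?thesis by (simp add: R_def)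
  qed
  have "antipodal_metric n (verts G) h p"
    unfolding antipodal_metric_def
  proof (intro conjI ballI allI)
    fix u assume u: "u \<in> verts G"
    have "R u u False 0" using conn_refl[OF u] by (simp add: R_def)
    then show "p u u False = 0" using p_le by fastforce
    have "R u u True n" by (simp add: R_def)
    then have "p u u True \<le> n" by (rule p_le)
    moreover have "n \<le> p u u True"
      using Rp[of u u True] conn_closed(2) by (auto simp: R_def)
    ultimately show "p u u True = n" by simp
  next
    fix u v s
    show "p u v s = p v u s" using p_le R_sym Rp by (metis le_antisym)
    show "even (p u v s) \<longleftrightarrow> (h u = h v \<longleftrightarrow> s \<longrightarrow> even n)" using R_par Rp by blast
  next
    fix u v w s t
    show "p u w (s \<noteq> t) \<le> p u v s + p v w t" using p_le R_trans Rp by blast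
  qed
  moreover have "p u v (neg u v) = 1" if "adj u v" for u v
  proof -
    have c: "conn u v (neg u v) 1" using conn_edge[OF that] .
    then have "p u v (neg u v) \<le> 1" by (intro p_le) (simp add: R_def)
    moreover have "odd (p u v (neg u v))" using R_par[OF Rp] h[OF c] by simp
    ultimately show ?thesis by (cases "p u v (neg u v)") auto
  qed
  ultimately show ?thesis using that by blast
qed

text \<open>The positive distances of a tight metric serve as \<open>d\<close>. The triangle
  inequality through the antipode of \<open>v\<close> bounds \<open>d u w\<close> by
  \<open>(n - d u v) + (n - d v w)\<close>, which is the perimeter condition.\<close>

lemma hypercube_distance_exists:
  obtains d where "\<And>u. u \<in> verts G \<Longrightarrow> d u u = 0"
    "\<And>u v. u \<in> verts G \<Longrightarrow> v \<in> verts G \<Longrightarrow> d u v = d v u"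
    "\<And>u v w. u \<in> verts G \<Longrightarrow> v \<in> verts G \<Longrightarrow> w \<in> verts G \<Longrightarrow> hypercube_triple n (d u v) (d u w) (d v w)"
    "\<And>u v. adj u v \<Longrightarrow> d u v = (if neg u v then n - 1 else 1)"
proof -
  obtain h p where p: "antipodal_metric n (verts G) h p" and p1: "\<And>u v. adj u v \<Longrightarrow> p u v (neg u v) = 1"
    using antipodal_metric_exists by blast
  obtain q where q: "antipodal_metric n (verts G) h q" and qp: "\<And>x y s. q x y s \<le> p x y s"
    and tight: "\<And>x y. x \<in> verts G \<Longrightarrow> y \<in> verts G \<Longrightarrow> q x y False + q x y True = n"
    using tight_antipodal_metric_exists[OF n fin p] by blast
  note Q = antipodal_metricD[OF q]
  show ?thesis
  proof (rule that[of "\<lambda>u v. q u v False"])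
    fix u v w assume V: "u \<in> verts G" "v \<in> verts G" "w \<in> verts G"
    have "even (q u v False + q u w False + q v w False)"
      using Q(4)[OF V(1,2), of False] Q(4)[OF V(1,3), of False] Q(4)[OF V(2,3), of False]
      unfolding even_add by blast
    moreover have "q u v False \<le> q u w False + q w v False" "q u w False \<le> q u v False + q v w False"
      "q v w False \<le> q v u False + q u w False" "q u w False \<le> q u v True + q v w True"
      using V by (auto intro: Q(5))
    moreover have "q w v False = q v w False" "q v u False = q u v False" using V Q(3) by blast+
    ultimately show "hypercube_triple n (q u v False) (q u w False) (q v w False)"
      using tight[OF V(1,2)] tight[OF V(2,3)] by (simp add: hypercube_triple_def)
  next
    fix u v assume a: "adj u v"
    have V: "u \<in> verts G" "v \<in> verts G" using adj_verts[OF a] by auto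
    have "q u v (neg u v) \<le> 1" using qp[of u v "neg u v"] p1[OF a] by simp
    \<comment> \<open>Tightening cannot shorten an edge to 0, since it preserves parity.\<close>
    moreover have "even (q u v (neg u v)) \<longleftrightarrow> even (p u v (neg u v))"
      using Q(4)[OF V] antipodal_metricD(4)[OF p V] by blast
    ultimately have "q u v (neg u v) = 1" using p1[OF a] by (cases "q u v (neg u v)") auto
    then show "q u v False = (if neg u v then n - 1 else 1)"
      using tight[OF V] by (cases "neg u v") auto
  qed (use Q in auto)
qed

end

subsection \<open>Homomorphisms to signed projective cubes\<close>

text \<open>Vertices of \<open>SPC k\<close> are the subsets of \<open>{..k}\<close> up to complementation, which is switching;
  we represent each class by the member avoiding \<open>0\<close>.\<close>

definition cube_vertex :: "nat \<Rightarrow> nat set \<Rightarrow> bit list" where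
  "cube_vertex k X = map (\<lambda>i. of_bool ((Suc i \<in> X) \<noteq> (0 \<in> X))) [0..<k]"

lemma hamming_cube_vertex:
  "hamming (cube_vertex k X) (cube_vertex k Y) =
     card {i. i < k \<and> (Suc i \<in> sym_diff X Y) \<noteq> (0 \<in> sym_diff X Y)}"
  unfolding hamming_def cube_vertex_def by (rule arg_cong[of _ _ card]) auto

lemma card_subset_shift:
  assumes "Z \<subseteq> {..<Suc k}"
  shows "card Z = card {i. i < k \<and> Suc i \<in> Z} + of_bool (0 \<in> Z)"
proof -
  let ?A = "Suc ` {i. i < k \<and> Suc i \<in> Z}"
  have "card ?A = card {i. i < k \<and> Suc i \<in> Z}" by (simp add: card_image)
  moreover have "Z = (if 0 \<in> Z then insert 0 ?A else ?A)"
  proof (rule set_eqI)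
    fix x show "x \<in> Z \<longleftrightarrow> x \<in> (if 0 \<in> Z then insert 0 ?A else ?A)"
      using assms by (cases x) auto
  qed
  then have "card Z = card (if 0 \<in> Z then insert 0 ?A else ?A)" by simp
  ultimately show ?thesis by (auto split: if_splits)
qed

text \<open>The factors -1 mark the sets that \<open>cube_vertex\<close> complements. Complementing
  one of two sets turns distance \<open>d\<close> into \<open>k + 1 - d\<close>, which exchanges 1
  and \<open>k\<close> just as the sign is reversed.\<close>

lemma SPC_edge_cube_vertex:
  assumes k: "1 \<le> k" and X: "X \<subseteq> {..<k + 1}" and Y: "Y \<subseteq> {..<k + 1}"
    and s: "card (sym_diff X Y) = (if s = -1 then k else 1)" "s = 1 \<or> s = -1"
  shows "({cube_vertex k X, cube_vertex k Y},
     (if 0 \<in> X then -1 else 1) * (if 0 \<in> Y then -1 else 1) * s) \<in> edges (SPC k)"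
proof -
  define Z where "Z = sym_diff X Y"
  define N where "N = card {i. i < k \<and> Suc i \<in> Z}"
  have Z: "Z \<subseteq> {..<Suc k}" using X Y by (auto simp: Z_def)
  have cZ: "card Z = N + of_bool (0 \<in> Z)" using card_subset_shift[OF Z] by (simp add: N_def)
  have "card {i. i < k \<and> Suc i \<notin> Z} = card ({..<k} - {i. i < k \<and> Suc i \<in> Z})"
    by (rule arg_cong[of _ _ card]) auto
  also have "\<dots> = k - N" unfolding N_def by (subst card_Diff_subset) auto
  finally have co: "card {i. i < k \<and> Suc i \<notin> Z} = k - N" .
  have ham: "hamming (cube_vertex k X) (cube_vertex k Y) = (if 0 \<in> Z then k - N else N)"
    using co by (simp add: hamming_cube_vertex Z_def[symmetric] N_def)
  have sgn: "(if 0 \<in> X then -1 else 1) * (if 0 \<in> Y then -1 else 1) * s = (if 0 \<in> Z then - s else s)"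
    by (auto simp: Z_def)
  have len: "length (cube_vertex k X) = k" "length (cube_vertex k Y) = k" by (auto simp: cube_vertex_def)
  let ?s = "if 0 \<in> Z then - s else s"
  have "?s = 1 \<and> hamming (cube_vertex k X) (cube_vertex k Y) = 1 \<or>
      ?s = -1 \<and> hamming (cube_vertex k X) (cube_vertex k Y) = k"
    using s cZ k unfolding ham Z_def[symmetric] by (cases "0 \<in> Z") auto
  then show ?thesis unfolding sgn SPC_def using len by auto
qed

lemma (in simple_signed_graph) admits_hom_SPC:
  assumes k: "1 \<le> k"
    and F: "\<And>v. v \<in> verts G \<Longrightarrow> F v \<subseteq> {..<k + 1}"
    and card: "\<And>u v. adj u v \<Longrightarrow> card (sym_diff (F u) (F v)) = (if neg u v then k else 1)"
  shows "admits_hom G (SPC k)"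
proof -
  define \<tau> :: "'v \<Rightarrow> int" where "\<tau> v = (if 0 \<in> F v then -1 else 1)" for v
  define f where "f v = cube_vertex k (F v)" for v
  define g where "g e = (f ` ends G e, (\<Prod>v\<in>ends G e. \<tau> v) * esign G e)" for e
  have "signed_hom G (SPC k) f g"
  proof (rule switching_signed_hom[where \<tau> = \<tau>])
    show "f v \<in> verts (SPC k)" for v by (simp add: f_def cube_vertex_def SPC_def)
    show "\<tau> v = 1 \<or> \<tau> v = -1" for v by (simp add: \<tau>_def)
  next
    fix e assume e: "e \<in> edges G"
    then obtain u v where uv: "ends G e = {u, v}" "u \<noteq> v" using card_ends[OF e] by (auto simp: card_2_iff)
    have a: "adj u v" using e uv by (auto simp: adj_def)
    have eq: "edge u v = e" using edge_eq e uv by blast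
    have V: "u \<in> verts G" "v \<in> verts G" using adj_verts[OF a] by auto
    have "({cube_vertex k (F u), cube_vertex k (F v)}, \<tau> u * \<tau> v * esign G e) \<in> edges (SPC k)"
      unfolding \<tau>_def
      by (rule SPC_edge_cube_vertex) (use k F V card[OF a] esign_edge[OF a] in \<open>auto simp: eq\<close>)
    then show "g e \<in> edges (SPC k) \<and> ends (SPC k) (g e) = f ` ends G e"
      using uv by (simp add: g_def f_def SPC_def)
  next
    fix e u v assume e: "e \<in> edges G" and uv: "ends G e = {u, v}"
    then have "u \<noteq> v" using card_ends by force
    then show "esign (SPC k) (g e) = \<tau> u * \<tau> v * esign G e"
      by (simp add: g_def uv SPC_def)
  qed
  then show ?thesis by (auto simp: admits_hom_def)
qed

lemma admissible_partial_3_tree_admits_hom: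
  assumes k: "1 \<le> k" and G: "signed_graph G" and T: "partial_3_tree G"
    and cycles: "\<And>vs es. cycle_in G vs es \<Longrightarrow> admissible (k + 1) (length vs) (sign_of G es)"
  shows "admits_hom G (SPC k)"
proof -
  obtain V :: "nat set" and E \<phi> where tree: "three_tree V E" and \<phi>: "inj_on \<phi> (verts G)" "\<phi> ` verts G \<subseteq> V"
    and E: "\<And>e. e \<in> edges G \<Longrightarrow> \<phi> ` ends G e \<in> E" and inj: "inj_on (ends G) (edges G)"
    using T by (auto simp: partial_3_tree_def)
  have wf: "finite V" "\<And>e. e \<in> E \<Longrightarrow> card e = 2" using three_tree_wf[OF tree] by auto
  have sub: "ends G e \<subseteq> verts G" if "e \<in> edges G" for e
    using G that by (simp add: signed_graph_def)
  interpret simple_signed_graph G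
  proof
    fix e assume e: "e \<in> edges G"
    have "card (\<phi> ` ends G e) = card (ends G e)"
      using inj_on_subset[OF \<phi>(1) sub[OF e]] by (rule card_image)
    then show "card (ends G e) = 2" using E[OF e] wf by simp
  qed (use G inj in auto)
  interpret admissible_graph G "k + 1"
  proof
    show "finite (verts G)" using \<phi> wf(1) by (meson finite_imageD finite_subset)
  qed (use k cycles in auto)
  show ?thesis
  \<comment> \<open>An empty graph offers no vertex to collapse the rest of the 3-tree onto.\<close>
  proof (cases "verts G = {}")
    case True
    then show ?thesis using adj_verts by (intro admits_hom_SPC[OF k, of "\<lambda>_. {}"]) auto
  next
    case False
    then obtain v0 where v0: "v0 \<in> verts G" by blast
    obtain d where d: "\<And>u. u \<in> verts G \<Longrightarrow> d u u = 0"
      "\<And>u v. u \<in> verts G \<Longrightarrow> v \<in> verts G \<Longrightarrow> d u v = d v u"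
      "\<And>u v w. u \<in> verts G \<Longrightarrow> v \<in> verts G \<Longrightarrow> w \<in> verts G \<Longrightarrow> hypercube_triple (k + 1) (d u v) (d u w) (d v w)"
      "\<And>u v. adj u v \<Longrightarrow> d u v = (if neg u v then (k + 1) - 1 else 1)"
      using hypercube_distance_exists by blast
    text \<open>The distance is pulled back to the whole 3-tree by collapsing its additional vertices
      to \<open>v0\<close>.\<close>
    define \<rho> where "\<rho> x = (if x \<in> \<phi> ` verts G then inv_into (verts G) \<phi> x else v0)" for x
    have \<rho>: "\<rho> x \<in> verts G" for x using v0 by (auto simp: \<rho>_def inv_into_into)
    have \<rho>\<phi>: "\<rho> (\<phi> v) = v" if "v \<in> verts G" for v using that \<phi>(1) by (simp add: \<rho>_def)
    \<comment> \<open>The triple condition holds for repeated vertices as well, so it survives the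
      collapse.\<close>
    have "\<exists>F. (\<forall>v\<in>V. F v \<subseteq> {..<k + 1}) \<and>
       (\<forall>x y. {x, y} \<in> E \<longrightarrow> card (sym_diff (F x) (F y)) = d (\<rho> x) (\<rho> y))"
      by (rule three_tree_hypercube_embedding[OF tree]) (use d \<rho> in auto)
    then obtain F where F: "\<And>v. v \<in> V \<Longrightarrow> F v \<subseteq> {..<k + 1}"
      "\<And>x y. {x, y} \<in> E \<Longrightarrow> card (sym_diff (F x) (F y)) = d (\<rho> x) (\<rho> y)" by blast
    show ?thesis
    proof (rule admits_hom_SPC[OF k, of "F \<circ> \<phi>"])
      show "(F \<circ> \<phi>) v \<subseteq> {..<k + 1}" if "v \<in> verts G" for v using that F(1) \<phi>(2) by auto
    next
      fix u v assume a: "adj u v"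
      then have "{\<phi> u, \<phi> v} \<in> E" using E by (fastforce simp: adj_def)
      then show "card (sym_diff ((F \<circ> \<phi>) u) ((F \<circ> \<phi>) v)) = (if neg u v then k else 1)"
        using F(2) adj_verts[OF a] \<rho>\<phi> d(4)[OF a] by simp
    qed
  qed
qed

section \<open>Forbidden signed cycles as cycles that are not admissible\<close>

theorem theorem6:
  fixes k :: nat and G :: "('v, 'e) sgraph"
  assumes "k \<ge> 1"
    and "signed_graph G"
    and "partial_3_tree G"
  shows "admits_hom G (SPC k) \<longleftrightarrow> \<not> (\<exists>C. signed_subgraph C G \<and> C \<in> O_class (k + 1))"
proof
  assume "admits_hom G (SPC k)"
  then obtain f g where hom: "signed_hom G (SPC k) f g" by (auto simp: admits_hom_def)
  show "\<not> (\<exists>C. signed_subgraph C G \<and> C \<in> O_class (k + 1))"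
  proof
    assume "\<exists>C. signed_subgraph C G \<and> C \<in> O_class (k + 1)"
    then obtain C vs es where sub: "signed_subgraph C G" and C: "signed_graph C"
      and cyc: "cycle_in C vs es" "set vs = verts C" "set es = edges C"
      and no: "\<not> admits_hom C (neg_cycle (k + 1))"
      by (auto simp: O_class_def signed_cycle_def)
    have "cycle_in G vs es" using sub cyc(1) by (auto simp: cycle_in_def signed_subgraph_def subset_iff)
    from SPC_image_admissible[OF assms(1) hom this]
    have "admissible (k + 1) (length vs) (sign_of G es)" .
    moreover have "sign_of G es = sign_of C es"
      using sub cyc(3) by (auto simp: sign_of_def signed_subgraph_def intro!: arg_cong[of _ _ prod_list])
    ultimately show False
      using admissible_admits_hom_neg_cycle[OF _ C cyc] no assms(1) by simp
  qed
next
  assume no: "\<not> (\<exists>C. signed_subgraph C G \<and> C \<in> O_class (k + 1))"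
  show "admits_hom G (SPC k)"
  proof (rule admissible_partial_3_tree_admits_hom[OF assms])
    fix vs es assume cyc: "cycle_in G vs es"
    \<comment> \<open>The cycle is turned into a subgraph of its own. Not being forbidden, it maps
      to the negative cycle, and this makes it admissible.\<close>
    define C :: "('v, 'e) sgraph" where
      "C = \<lparr>verts = set vs, edges = set es, ends = ends G, esign = esign G\<rparr>"
    have "ends G e \<subseteq> set vs" if e: "e \<in> set es" for e
    proof -
      obtain i where i: "i < length vs" "e = es ! i"
        using e cyc in_set_conv_nth[of e es] by (auto simp: cycle_in_def)
      then have "Suc i mod length vs < length vs" by (intro mod_less_divisor) auto
      then show ?thesis using cyc i by (simp add: cycle_in_def)
    qed
    then have C: "signed_graph C"
      using assms(2) cyc by (auto simp: signed_graph_def C_def cycle_in_def)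
    have sub: "signed_subgraph C G" using C cyc by (auto simp: signed_subgraph_def C_def cycle_in_def)
    have cycC: "cycle_in C vs es" using cyc by (simp add: cycle_in_def C_def)
    then have "signed_cycle C" using C by (auto simp: signed_cycle_def C_def)
    then have "admits_hom C (neg_cycle (k + 1))" using no sub by (auto simp: O_class_def)
    then obtain f g where "signed_hom C (neg_cycle (k + 1)) f g" by (auto simp: admits_hom_def)
    from neg_cycle_image_admissible[OF _ this cycC] assms(1)
    show "admissible (k + 1) (length vs) (sign_of G es)" by (simp add: sign_of_def C_def)
  qed
qed

end
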